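(* Let $\mathcal{A}=\{A_1,\dots,A_k\}$ be an affine subspace arrangement in $\mathbb{R}^n$, with Ziegler–Živaljević diagram $\mathcal{ZZ}$ and Vassiliev diagram $\mathcal{V}$. Then $\mathrm{hocolim}(\mathcal{ZZ})\cup\{\infty\}$ is a deformation retract of $\mathrm{hocolim}(\mathcal{V})\cup\{\infty\}$ (one-point compactifications), where $\mathrm{hocolim}(\mathcal{ZZ})$ is regarded as a subspace of $\mathrm{hocolim}(\mathcal{V})$ via the identifications described below.
   Context: An affine subspace arrangement is a finite collection $\mathcal{A}=\{A_1,\dots,A_k\}$ of affine subspaces of $\mathbb{R}^n$ such that $A_i\subseteq A_j$ implies $A_i=A_j$. Its intersection semilattice $\mathcal{L}(\mathcal{A})$ is the set of all nonempty intersections of the $A_i$'s ordered by reverse inclusion; for $x\in\mathcal{L}(\mathcal{A})$, $B(x)$ is the corresponding affine subspace, and $a_i$ denotes the element corresponding to $A_i$. Diagrams and homotopy colimits: a poset is a category with a morphism $x\to y$ whenever $x\geq y$; a diagram over a poset $P$ is a functor $\mathcal{D}:P\to\mathbf{Top}$. $\Delta(Q)$ is the geometric realization of the order complex of a poset $Q$ (simplices = nonempty chains); $P_{\leq x}=\{y:y\leq x\}$; $I(y\hookrightarrow x):\Delta(P_{\leq y})\hookrightarrow\Delta(P_{\leq x})$ the inclusion. $\mathrm{Bd}(P)$ is the poset of nonempty chains $x_1>\dots>x_t$ of $P$ ordered by inclusion. $\mathrm{hocolim}(\mathcal{D})$ is the colimit in $\mathbf{Top}$ of the functor on $\mathrm{Bd}(P)$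 sending $(x_1>\dots>x_t)$ to $\Delta(P_{\leq x_t})\times\mathcal{D}(x_1)$ and the morphism to a subchain $(x_{i_1}>\dots>x_{i_p})$ ($i_1<\dots<i_p$) to $I(x_t\hookrightarrow x_{i_p})\times\mathcal{D}(x_1\to x_{i_1})$. For a diagram $\mathcal{D}$ over $P$, $\mathrm{Bd}(\mathcal{D})$ is the diagram over $\mathrm{Bd}(P)$ (the face poset of the simplicial complex $\Delta(P)$) with $\mathrm{Bd}(\mathcal{D})(x_1>\dots>x_k)=\mathcal{D}(x_1)$ and maps $\mathcal{D}(x_1\to x_{i_1})$; $\mathrm{hocolim}(\mathrm{Bd}(\mathcal{D}))$ is homeomorphic to $\mathrm{hocolim}(\mathcal{D})$. The Ziegler–Živaljević diagram $\mathcal{ZZ}$ over $\mathcal{L}(\mathcal{A})$ has $\mathcal{ZZ}(x)=B(x)$ and, for $x\geq y$, the inclusion $B(x)\hookrightarrow B(y)$. The nerve complex $\mathcal{N}(\mathcal{L}(\mathcal{A}))$ has vertex set $\{a_1,\dots,a_k\}$ and simplices the nonempty sets $\{a_{i_1},\dots,a_{i_m}\}$ with $A_{i_1}\cap\dots\cap A_{i_m}\neq\emptyset$. The Vassiliev diagram $\mathcal{V}$ over the face poset of $\mathcal{N}(\mathcal{L}(\mathcal{A}))$ (simplices ordered by inclusion) has $\mathcal{V}(\{a_{i_1},\dots,a_{i_m}\})=A_{i_1}\cap\dots\cap A_{i_m}$, with inclusion maps $A_{i_1}\cap\dots\cap A_{i_m}\hookrightarrow A_{j_1}\cap\dots\cap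 A_{j_q}$ for $\{j_1,\dots,j_q\}\subseteq\{i_1,\dots,i_m\}$. Identification: each $x\in\mathcal{L}(\mathcal{A})$ corresponds to the simplex $\{a_i: B(x)\subseteq A_i\}$ of $\mathcal{N}(\mathcal{L}(\mathcal{A}))$ (the "complete" simplices), and this identifies $\Delta(\mathcal{L}(\mathcal{A}))$ with the full subcomplex of the barycentric subdivision $\mathrm{Bd}(\mathcal{N}(\mathcal{L}(\mathcal{A})))$ spanned by the complete simplices; under it, $\mathrm{Bd}(\mathcal{ZZ})$ is the restriction of $\mathrm{Bd}(\mathcal{V})$ to this subcomplex, so $\mathrm{hocolim}(\mathrm{Bd}(\mathcal{ZZ}))\cong\mathrm{hocolim}(\mathcal{ZZ})$ is a subspace of $\mathrm{hocolim}(\mathrm{Bd}(\mathcal{V}))\cong\mathrm{hocolim}(\mathcal{V})$. *)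

theory Defs
  imports "HOL-Analysis.Analysis"
begin

section \<open>Quotient spaces and deformation retracts\<close>

definition quotient_space :: "'a topology \<Rightarrow> ('a \<times> 'a) set \<Rightarrow> 'a set topology" where
  "quotient_space X E =
     topology (\<lambda>\<U>. \<U> \<subseteq> topspace X // E \<and> openin X (\<Union>\<U>))"

lemma openin_quotient_space:
  assumes "equiv (topspace X) E"
  shows "openin (quotient_space X E) \<U> \<longleftrightarrow> \<U> \<subseteq> topspace X // E \<and> openin X (\<Union>\<U>)"
proof -
  have "istopology (\<lambda>\<U>. \<U> \<subseteq> topspace X // E \<and> openin X (\<Union>\<U>))"
    unfolding istopology_def
  proof (intro conjI allI impI)
    fix S T
    assume S: "S \<subseteq> topspace X // E \<and> openin X (\<Union>S)"
      and T: "T \<subseteq> topspace X // E \<and> openin X (\<Union>T)"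
    have "\<Union>(S \<inter> T) = \<Union>S \<inter> \<Union>T"
    proof (intro equalityI subsetI)
      fix x assume "x \<in> \<Union>S \<inter> \<Union>T"
      then obtain s t where "s \<in> S" "t \<in> T" "x \<in> s" "x \<in> t" by blast
      moreover from this have "s = t"
        using quotient_disj[OF assms] S T by blast
      ultimately show "x \<in> \<Union>(S \<inter> T)" by blast
    qed auto
    then show "openin X (\<Union>(S \<inter> T))"
      using S T by (simp add: openin_Int)
  next
    fix \<K>
    assume *: "\<forall>K\<in>\<K>. K \<subseteq> topspace X // E \<and> openin X (\<Union>K)"
    have "\<Union>(\<Union>\<K>) = \<Union>((\<lambda>K. \<Union>K) ` \<K>)" by auto
    with * show "openin X (\<Union>(\<Union>\<K>))" by (metis (no_types, lifting) imageE openin_Union)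
  qed blast+
  then show ?thesis by (simp add: quotient_space_def)
qed

text \<open>The homotopy from the identity to the retraction is stationary on the subspace
  throughout (the ``strong'' convention); evaluated at the end of the homotopy, the predicate
  says that the end map is a retraction.\<close>

definition deformation_retract_of_space :: "'a set \<Rightarrow> 'a topology \<Rightarrow> bool" where
  "deformation_retract_of_space S X \<longleftrightarrow>
     S \<subseteq> topspace X \<and>
     (\<exists>r. r ` topspace X \<subseteq> S \<and> homotopic_with (\<lambda>h. \<forall>x\<in>S. h x = x) X X id r)"

section \<open>Diagrams over posets, colimits and homotopy colimits\<close>

text \<open>A diagram over the poset with carrier \<open>objs\<close> and order \<open>leq\<close>. The poset is regarded as a
  category with one morphism \<open>p \<rightarrow> q\<close> whenever \<open>leq q p\<close>, and \<open>arr D p q\<close> is the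
  map attached to it.\<close>

record ('p, 'x) diagram =
  objs :: "'p set"
  leq :: "'p \<Rightarrow> 'p \<Rightarrow> bool"
  sp :: "'p \<Rightarrow> 'x topology"
  arr :: "'p \<Rightarrow> 'p \<Rightarrow> 'x \<Rightarrow> 'x"

definition is_diagram :: "('p, 'x) diagram \<Rightarrow> bool" where
  "is_diagram D \<longleftrightarrow>
     (\<forall>p\<in>objs D. leq D p p) \<and>
     (\<forall>p\<in>objs D. \<forall>q\<in>objs D. leq D p q \<longrightarrow> leq D q p \<longrightarrow> p = q) \<and>
     (\<forall>p\<in>objs D. \<forall>q\<in>objs D. \<forall>r\<in>objs D. leq D p q \<longrightarrow> leq D q r \<longrightarrow> leq D p r) \<and>
     (\<forall>p\<in>objs D. \<forall>q\<in>objs D. leq D q p \<longrightarrow> continuous_map (sp D p) (sp D q) (arr D p q)) \<and>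
     (\<forall>p\<in>objs D. \<forall>x\<in>topspace (sp D p). arr D p p x = x) \<and>
     (\<forall>p\<in>objs D. \<forall>q\<in>objs D. \<forall>r\<in>objs D. leq D q p \<longrightarrow> leq D r q \<longrightarrow>
        (\<forall>x\<in>topspace (sp D p). arr D q r (arr D p q x) = arr D p r x))"

text \<open>The colimit in the category of topological spaces: the coproduct of all the spaces modulo
  the equivalence relation generated by identifying each point with its images under the maps of
  the diagram.\<close>

definition glue :: "('p, 'x) diagram \<Rightarrow> 'p \<times> 'x \<Rightarrow> 'p \<times> 'x \<Rightarrow> bool" where
  "glue D = (\<lambda>(p, x) (q, y). p \<in> objs D \<and> q \<in> objs D \<and> leq D q p \<and>
                                x \<in> topspace (sp D p) \<and> y = arr D p q x)"

definition colim_eqv :: "('p, 'x) diagram \<Rightarrow> (('p \<times> 'x) \<times> ('p \<times> 'x)) set" where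
  "colim_eqv D = {(z, w). z \<in> topspace (sum_topology (sp D) (objs D)) \<and>
                          w \<in> topspace (sum_topology (sp D) (objs D)) \<and> equivclp (glue D) z w}"

definition colim :: "('p, 'x) diagram \<Rightarrow> ('p \<times> 'x) set topology" where
  "colim D = quotient_space (sum_topology (sp D) (objs D)) (colim_eqv D)"

lemma equiv_colim_eqv: "equiv (topspace (sum_topology (sp D) (objs D))) (colim_eqv D)"
  by (rule equivI)
     (auto simp: colim_eqv_def refl_on_def sym_def trans_def
           intro: equivclp_sym equivclp_trans)

text \<open>The map of colimits induced by a map \<open>f\<close> of the coproducts which respects the gluing,
  where \<open>E\<close> is the target diagram: the class \<open>K\<close> goes to the class containing \<open>f ` K\<close>.\<close>

definition colim_map ::
  "('q, 'y) diagram \<Rightarrow> ('p \<times> 'x \<Rightarrow> 'q \<times> 'y) \<Rightarrow> ('p \<times> 'x) set \<Rightarrow> ('q \<times> 'y) set" where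
  "colim_map E f K = colim_eqv E `` (f ` K)"

text \<open>Nonempty finite chains \<open>x\<^sub>1 > \<dots> > x\<^sub>t\<close> are encoded by their sets of elements.\<close>

definition nchains :: "('p \<Rightarrow> 'p \<Rightarrow> bool) \<Rightarrow> 'p set \<Rightarrow> 'p set set" where
  "nchains le P = {c. c \<noteq> {} \<and> finite c \<and> c \<subseteq> P \<and> (\<forall>x\<in>c. \<forall>y\<in>c. le x y \<or> le y x)}"

definition chain_max :: "('p \<Rightarrow> 'p \<Rightarrow> bool) \<Rightarrow> 'p set \<Rightarrow> 'p" where
  "chain_max le c = (THE x. x \<in> c \<and> (\<forall>y\<in>c. le y x))"

definition chain_min :: "('p \<Rightarrow> 'p \<Rightarrow> bool) \<Rightarrow> 'p set \<Rightarrow> 'p" where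
  "chain_min le c = (THE x. x \<in> c \<and> (\<forall>y\<in>c. le x y))"

text \<open>The geometric realization of the order complex of a finite poset, in barycentric
  coordinates. Coordinates are total functions vanishing off the poset, so the realization of a
  subposet is literally a subspace. For infinite posets one would need the weak
  topology in place of the product topology.\<close>

definition order_complex :: "('p \<Rightarrow> 'p \<Rightarrow> bool) \<Rightarrow> 'p set \<Rightarrow> ('p \<Rightarrow> real) topology" where
  "order_complex le P = subtopology (powertop_real UNIV)
     {\<alpha>. (\<forall>p. 0 \<le> \<alpha> p) \<and> {p. \<alpha> p \<noteq> 0} \<in> nchains le P \<and> sum \<alpha> {p. \<alpha> p \<noteq> 0} = 1}"

definition hocolim_diagram ::
  "('p, 'x) diagram \<Rightarrow> ('p set, ('p \<Rightarrow> real) \<times> 'x) diagram" where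
  "hocolim_diagram D = \<lparr>
     objs = nchains (leq D) (objs D),
     leq = (\<subseteq>),
     sp = (\<lambda>c. prod_topology
                  (order_complex (leq D) {y \<in> objs D. leq D y (chain_min (leq D) c)})
                  (sp D (chain_max (leq D) c))),
     arr = (\<lambda>c c'. map_prod id (arr D (chain_max (leq D) c) (chain_max (leq D) c'))) \<rparr>"

definition hocolim :: "('p, 'x) diagram \<Rightarrow> ('p set \<times> (('p \<Rightarrow> real) \<times> 'x)) set topology" where
  "hocolim D = colim (hocolim_diagram D)"

section \<open>Barycentric subdivision of a diagram\<close>

definition Bd :: "('p, 'x) diagram \<Rightarrow> ('p set, 'x) diagram" where
  "Bd D = \<lparr>
     objs = nchains (leq D) (objs D),
     leq = (\<subseteq>),
     sp = (\<lambda>c. sp D (chain_max (leq D) c)),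
     arr = (\<lambda>c c'. arr D (chain_max (leq D) c) (chain_max (leq D) c')) \<rparr>"

text \<open>The homeomorphism from the realization of the barycentric subdivision to the realization of
  the complex, affine on simplices and sending the vertex \<open>c\<close> to the barycenter of the simplex
  \<open>c\<close>.\<close>

definition bary :: "('p set \<Rightarrow> real) \<Rightarrow> 'p \<Rightarrow> real" where
  "bary \<alpha> x = (\<Sum>c | \<alpha> c \<noteq> 0 \<and> x \<in> c. \<alpha> c / real (card c))"

text \<open>The canonical homeomorphism from \<open>hocolim (Bd D)\<close> to \<open>hocolim D\<close>. On representatives,
  \<open>C = (c\<^sub>1 \<supset> \<dots> \<supset> c\<^sub>s)\<close> is a chain of chains, whose largest elements form the chain
  \<open>max c\<^sub>1 \<ge> \<dots> \<ge> max c\<^sub>s\<close>; the coordinate \<open>\<alpha>\<close> is supported on chains contained in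
  \<open>c\<^sub>s\<close>, so \<open>bary \<alpha>\<close> is supported below \<open>max c\<^sub>s\<close>; and the point
  \<open>d\<close> lies in \<open>Bd D (c\<^sub>1) = D (max c\<^sub>1)\<close> on both sides.\<close>

definition hocolim_Bd_map :: "('p, 'x) diagram \<Rightarrow>
    ('p set set \<times> (('p set \<Rightarrow> real) \<times> 'x)) set \<Rightarrow> ('p set \<times> (('p \<Rightarrow> real) \<times> 'x)) set" where
  "hocolim_Bd_map D = colim_map (hocolim_diagram D)
     (\<lambda>(C, (\<alpha>, d)). (chain_max (leq D) ` C, (bary \<alpha>, d)))"

text \<open>The map of homotopy colimits induced by an order embedding \<open>\<phi>\<close> of the index posets along
  which the first diagram is the restriction of the second diagram \<open>E\<close>. It is the simplicial
  map induced by \<open>\<phi>\<close> on order complexes and the identity on the spaces.\<close>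

definition push_coords :: "('p \<Rightarrow> 'q) \<Rightarrow> ('p \<Rightarrow> real) \<Rightarrow> 'q \<Rightarrow> real" where
  "push_coords \<phi> \<alpha> q = (\<Sum>p | \<alpha> p \<noteq> 0 \<and> \<phi> p = q. \<alpha> p)"

definition hocolim_restr_map :: "('q, 'x) diagram \<Rightarrow> ('p \<Rightarrow> 'q) \<Rightarrow>
    ('p set \<times> (('p \<Rightarrow> real) \<times> 'x)) set \<Rightarrow> ('q set \<times> (('q \<Rightarrow> real) \<times> 'x)) set" where
  "hocolim_restr_map E \<phi> = colim_map (hocolim_diagram E)
     (\<lambda>(c, (\<alpha>, d)). (\<phi> ` c, (push_coords \<phi> \<alpha>, d)))"

section \<open>Affine subspace arrangements and their diagrams\<close>

definition affine_arrangement :: "'a::real_vector set set \<Rightarrow> bool" where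
  "affine_arrangement \<A> \<longleftrightarrow>
     finite \<A> \<and> (\<forall>a\<in>\<A>. affine a \<and> a \<noteq> {}) \<and> (\<forall>a\<in>\<A>. \<forall>b\<in>\<A>. a \<subseteq> b \<longrightarrow> a = b)"

text \<open>An element of the intersection semilattice is represented by the affine subspace it
  corresponds to. Only intersections of at least one member are taken, so the whole space is not
  adjoined as a bottom element.\<close>

definition intersections :: "'a set set \<Rightarrow> 'a set set" where
  "intersections \<A> = {\<Inter>S | S. S \<subseteq> \<A> \<and> S \<noteq> {} \<and> \<Inter>S \<noteq> {}}"

definition ZZ :: "'a::topological_space set set \<Rightarrow> ('a set, 'a) diagram" where
  "ZZ \<A> = \<lparr> objs = intersections \<A>, leq = (\<lambda>x y. y \<subseteq> x),
            sp = (\<lambda>x. top_of_set x), arr = (\<lambda>x y. id) \<rparr>"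

definition nerve :: "'a set set \<Rightarrow> 'a set set set" where
  "nerve \<A> = {\<sigma>. \<sigma> \<noteq> {} \<and> \<sigma> \<subseteq> \<A> \<and> \<Inter>\<sigma> \<noteq> {}}"

definition Vassiliev :: "'a::topological_space set set \<Rightarrow> ('a set set, 'a) diagram" where
  "Vassiliev \<A> = \<lparr> objs = nerve \<A>, leq = (\<subseteq>),
                   sp = (\<lambda>\<sigma>. top_of_set (\<Inter>\<sigma>)), arr = (\<lambda>\<sigma> \<tau>. id) \<rparr>"

lemma is_diagram_ZZ: "is_diagram (ZZ \<A>)"
  by (auto simp: is_diagram_def ZZ_def)

lemma is_diagram_Vassiliev: "is_diagram (Vassiliev \<A>)"
  by (auto simp: is_diagram_def Vassiliev_def)

definition complete_simplex :: "'a set set \<Rightarrow> 'a set \<Rightarrow> 'a set set" where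
  "complete_simplex \<A> x = {a \<in> \<A>. x \<subseteq> a}"

lemma complete_simplex_props:
  assumes "x \<in> intersections \<A>"
  shows "complete_simplex \<A> x \<in> nerve \<A>" and "\<Inter>(complete_simplex \<A> x) = x"
proof -
  obtain S where S: "x = \<Inter>S" "S \<subseteq> \<A>" "S \<noteq> {}" "\<Inter>S \<noteq> {}"
    using assms unfolding intersections_def by blast
  then have sub: "S \<subseteq> complete_simplex \<A> x"
    by (auto simp: complete_simplex_def)
  then show eq: "\<Inter>(complete_simplex \<A> x) = x"
    using S by (auto simp: complete_simplex_def)
  show "complete_simplex \<A> x \<in> nerve \<A>"
    using S sub eq by (auto simp: nerve_def complete_simplex_def)
qed

text \<open>The embedding through which \<open>hocolim (ZZ \<A>)\<close> is regarded as a subspace of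
  \<open>hocolim (Vassiliev \<A>)\<close>: the composite
  \<open>hocolim ZZ \<cong> hocolim (Bd ZZ) \<rightarrow> hocolim (Bd Vassiliev) \<cong> hocolim Vassiliev\<close>,
  whose middle map sends a chain of the semilattice to the corresponding chain of complete
  simplices.\<close>

definition ZZ_to_Vassiliev :: "'a::topological_space set set \<Rightarrow>
    ('a set set \<times> (('a set \<Rightarrow> real) \<times> 'a)) set \<Rightarrow>
    ('a set set set \<times> (('a set set \<Rightarrow> real) \<times> 'a)) set" where
  "ZZ_to_Vassiliev \<A> =
     hocolim_Bd_map (Vassiliev \<A>) \<circ>
     hocolim_restr_map (Bd (Vassiliev \<A>)) (\<lambda>c. complete_simplex \<A> ` c) \<circ>
     inv_into (topspace (hocolim (Bd (ZZ \<A>)))) (hocolim_Bd_map (ZZ \<A>))"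

end

theory Submission
  imports Defs
begin

text \<open>All maps in the diagrams are inclusions of closed subspaces and the posets are finite, so
  each homotopy colimit is the closed subspace of pairs \<open>(\<alpha>, x)\<close>, with \<open>\<alpha>\<close> in the order
  complex and \<open>x\<close> in the space of every vertex of the support of \<open>\<alpha>\<close>. The embedding of
  \<open>hocolim (ZZ \<A>)\<close> pushes \<open>\<alpha>\<close> forward along \<open>x \<mapsto> complete_simplex \<A> x\<close>: barycentric
  coordinates are compatible with injective relabelling of the vertices. The map
  \<open>\<sigma> \<mapsto> complete_simplex \<A> (\<Inter>\<sigma>)\<close> is a closure operator on the face poset of the nerve
  which does not change \<open>\<Inter>\<sigma>\<close>, so the deformation of the order complex onto the closed elements
  lifts to the homotopy colimit without moving \<open>x\<close>. The order complex being compact, this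
  homotopy and the embedding are proper and extend to the one-point compactifications.\<close>

section \<open>Alexandroff compactifications and quotients\<close>

text \<open>A point of \<open>hocolim\<close> is a class of representatives, and no map is analysed
  on classes: \<open>hocolim_pt\<close> reads the pair (\<alpha>, x) off a class, and maps are
  compared through these pairs. The embedding is built from the inverse of the subdivision
  homeomorphism. In coordinates this amounts to picking some preimage of each point: whichever is
  picked, relabelling its vertices and then applying \<open>bary\<close> gives the relabelled
  original weights. Continuity at infinity is a question of properness, and it has one answer for
  the embedding and for the homotopy: both change the weights alone, so a bound on x in the target
  is a bound on x in the source, while weights and time range over compact sets. The embedding
  property then follows by compactness, because an injective continuous map from a compact space to
  a Hausdorff space is an embedding.\<close>

lemma openin_Alexandroff_prod_image:
  assumes "openin (prod_topology T X) W"
  shows "openin (prod_topology T (Alexandroff_compactification X)) (map_prod id Some ` W)"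
  unfolding openin_prod_topology_alt
proof (intro allI impI)
  fix t u
  assume "(t, u) \<in> map_prod id Some ` W"
  then obtain x where x: "u = Some x" "(t, x) \<in> W" by auto
  with assms obtain U V where UV: "openin T U" "openin X V" "t \<in> U" "x \<in> V" "U \<times> V \<subseteq> W"
    unfolding openin_prod_topology_alt by meson
  have "U \<times> Some ` V \<subseteq> map_prod id Some ` W"
    using UV(5) by force
  then show "\<exists>U' V'. openin T U' \<and> openin (Alexandroff_compactification X) V' \<and> t \<in> U' \<and> u \<in> V' \<and>
      U' \<times> V' \<subseteq> map_prod id Some ` W"
    using UV x by (meson imageI openin_Alexandroff_compactification_image_Some)
qed

text \<open>A neighbourhood of infinity is the complement of a closed compact C. Its preimage is the
  complement of the image of the set in \<open>proper\<close>; that image is compact, hence closed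
  in a Hausdorff product. Properness is required jointly in time and space, since joint continuity
  is what a homotopy needs.\<close>

lemma continuous_map_Alexandroff_homotopy:
  assumes h: "continuous_map (prod_topology T X) Y (\<lambda>(t, x). h t x)"
    and proper: "\<And>C. \<lbrakk>compactin Y C; closedin Y C\<rbrakk> \<Longrightarrow>
        compactin (prod_topology T X) {(t, x) \<in> topspace (prod_topology T X). h t x \<in> C}"
    and T: "Hausdorff_space T" and X: "Hausdorff_space X" "locally_compact_space X"
  shows "continuous_map (prod_topology T (Alexandroff_compactification X))
           (Alexandroff_compactification Y) (\<lambda>(t, u). map_option (h t) u)"
    (is "continuous_map ?P ?Q ?H")
  unfolding continuous_map_alt
proof (intro conjI allI impI)
  have hY: "h t x \<in> topspace Y" if "t \<in> topspace T" "x \<in> topspace X" for t x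
    using continuous_map_funspace[OF h] that by (auto dest: funcset_mem[of _ _ _ "(t, x)"])
  then show "?H \<in> topspace ?P \<rightarrow> topspace ?Q" by auto
  fix V assume "openin ?Q V"
  then consider U where "openin Y U" "V = Some ` U"
    | C where "compactin Y C" "closedin Y C" "V = insert None (Some ` (topspace Y - C))"
    by (auto simp: openin_Alexandroff_compactification)
  then show "openin ?P (?H -` V \<inter> topspace ?P)"
  proof cases
    case 1
    let ?W = "{z \<in> topspace (prod_topology T X). (\<lambda>(t, x). h t x) z \<in> U}"
    have "openin (prod_topology T X) ?W"
      using openin_continuous_map_preimage[OF h 1(1)] .
    moreover have "?H -` V \<inter> topspace ?P = map_prod id Some ` ?W"
      unfolding 1 by (auto simp: image_iff map_prod_def split: prod.splits)
    ultimately show ?thesis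
      by (simp only: openin_Alexandroff_prod_image)
  next
    case 2
    let ?K = "{(t, x) \<in> topspace (prod_topology T X). h t x \<in> C}"
    have "continuous_map (prod_topology T X) ?P (map_prod id Some)"
      unfolding map_prod_def
      by (simp add: continuous_map_prod_top id_def continuous_map_Some)
    then have "compactin ?P (map_prod id Some ` ?K)"
      using proper[OF 2(1,2)] image_compactin by blast
    moreover have "Hausdorff_space ?P"
      using T X by (simp add: Hausdorff_space_prod_topology Hausdorff_space_Alexandroff_compactification)
    ultimately have "closedin ?P (map_prod id Some ` ?K)"
      by (simp add: compactin_imp_closedin)
    moreover have "?H -` V \<inter> topspace ?P = topspace ?P - map_prod id Some ` ?K"
      unfolding 2 using hY by (force simp: image_iff)
    ultimately show ?thesis
      by (simp only: openin_diff openin_topspace)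
  qed
qed

text \<open>The class projection and f are quotient maps of X with the same fibres, so their targets
  agree. The map p is constrained only by its values on classes, which suits a p defined by choosing
  representatives.\<close>

lemma homeomorphic_map_quotient_space:
  assumes E: "equiv (topspace X) E" and f: "quotient_map X Y f"
    and Ef: "\<And>x y. \<lbrakk>x \<in> topspace X; y \<in> topspace X\<rbrakk> \<Longrightarrow> (x, y) \<in> E \<longleftrightarrow> f x = f y"
    and p: "\<And>x. x \<in> topspace X \<Longrightarrow> p (E `` {x}) = f x"
  shows "homeomorphic_map (quotient_space X E) Y p"
proof -
  let ?Q = "quotient_space X E" and ?e = "\<lambda>x. E `` {x}"
  have E_sub: "E \<subseteq> topspace X \<times> topspace X"
    using E by (auto simp: equiv_def refl_on_def)
  have top: "topspace ?Q = topspace X // E"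
  proof -
    have "openin ?Q (topspace X // E)"
      using E by (simp add: openin_quotient_space Union_quotient)
    then have "topspace X // E \<subseteq> topspace ?Q" by (rule openin_subset)
    moreover have "topspace ?Q \<subseteq> topspace X // E"
      using openin_topspace[of ?Q] unfolding openin_quotient_space[OF E] by (rule conjunct1)
    ultimately show ?thesis by (rule subset_antisym[rotated])
  qed
  \<comment> \<open>This matches the definition of \<open>quotient_space\<close>, which calls a set
    of classes open if its union is open.\<close>
  have pre: "{x \<in> topspace X. ?e x \<in> U} = \<Union>U" if U: "U \<subseteq> topspace X // E" for U
  proof (rule set_eqI)
    fix x
    show "x \<in> {x \<in> topspace X. ?e x \<in> U} \<longleftrightarrow> x \<in> \<Union>U"
    proof
      assume "x \<in> {x \<in> topspace X. ?e x \<in> U}"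
      then have "x \<in> topspace X" "?e x \<in> U" by auto
      then show "x \<in> \<Union>U" using equiv_class_self[OF E] by (intro UnionI)
    next
      assume "x \<in> \<Union>U"
      then obtain K where K: "x \<in> K" "K \<in> U" by (rule UnionE)
      then obtain y where "K = ?e y" using U by (auto elim: quotientE)
      then have "(y, x) \<in> E" using K(1) by simp
      then have "x \<in> topspace X" "K = ?e x"
        using E_sub equiv_class_eq[OF E] \<open>K = ?e y\<close> by auto
      then show "x \<in> {x \<in> topspace X. ?e x \<in> U}" using K(2) by simp
    qed
  qed
  have e: "quotient_map X ?Q ?e"
    unfolding quotient_map_def
  proof (intro conjI allI impI)
    show "?e ` topspace X = topspace ?Q" by (auto simp: top quotient_def)
    fix U assume "U \<subseteq> topspace ?Q"
    then show "openin X {x \<in> topspace X. ?e x \<in> U} = openin ?Q U"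
      using pre E by (simp add: top openin_quotient_space)
  qed
  have pe: "quotient_map X Y (p \<circ> ?e)"
    using f by (rule quotient_map_eq) (simp add: p)
  have cp: "continuous_map ?Q Y p"
    using continuous_compose_quotient_map[OF e] quotient_imp_continuous_map[OF pe] by blast
  have "inj_on p (topspace ?Q)"
    unfolding top
  proof (rule inj_onI)
    fix K L assume "K \<in> topspace X // E" "L \<in> topspace X // E" and eq: "p K = p L"
    then obtain x y where "x \<in> topspace X" "K = ?e x" "y \<in> topspace X" "L = ?e y"
      by (meson quotientE)
    then show "K = L" using eq p Ef equiv_class_eq[OF E] by metis
  qed
  then show ?thesis
    using quotient_map_from_composition[OF quotient_imp_continuous_map[OF e] cp pe]
    by (simp add: homeomorphic_map_def)
qed

section \<open>Weights on chains\<close>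

text \<open>The point set underlying \<open>order_complex\<close>, named separately so that it can
  be treated as a subset of a function space with its type-class topology.\<close>

definition chain_weights :: "('p \<Rightarrow> 'p \<Rightarrow> bool) \<Rightarrow> 'p set \<Rightarrow> ('p \<Rightarrow> real) set" where
  "chain_weights le P = {\<alpha>. (\<forall>p. 0 \<le> \<alpha> p) \<and> {p. \<alpha> p \<noteq> 0} \<in> nchains le P \<and> sum \<alpha> {p. \<alpha> p \<noteq> 0} = 1}"

lemma order_complex_eq: "order_complex le P = top_of_set (chain_weights le P)"
  by (simp add: order_complex_def chain_weights_def euclidean_product_topology)

text \<open>Summing over the fixed set P instead of the varying support turns membership into
  conditions on coordinates. The support is nonempty because an empty one would have total weight
  0.\<close>

lemma chain_weights_iff:
  assumes "finite P"
  shows "\<alpha> \<in> chain_weights le P \<longleftrightarrow>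
    (\<forall>p. 0 \<le> \<alpha> p) \<and> (\<forall>p. \<alpha> p \<noteq> 0 \<longrightarrow> p \<in> P) \<and>
    (\<forall>p q. \<alpha> p \<noteq> 0 \<longrightarrow> \<alpha> q \<noteq> 0 \<longrightarrow> le p q \<or> le q p) \<and> sum \<alpha> P = 1" (is "?l \<longleftrightarrow> ?r")
proof -
  have *: "sum \<alpha> {p. \<alpha> p \<noteq> 0} = sum \<alpha> P" if "{p. \<alpha> p \<noteq> 0} \<subseteq> P"
    using assms that by (intro sum.mono_neutral_left) auto
  have "\<exists>p. \<alpha> p \<noteq> 0" if "sum \<alpha> P = 1"
    using that by (metis sum.neutral zero_neq_one)
  moreover have "finite {p. \<alpha> p \<noteq> 0}" if "{p. \<alpha> p \<noteq> 0} \<subseteq> P"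
    using assms that by (rule finite_subset[rotated])
  ultimately show ?thesis
    using * by (cases "{p. \<alpha> p \<noteq> 0} \<subseteq> P") (auto simp: chain_weights_def nchains_def)
qed

lemma chain_weights_supp: "\<alpha> \<in> chain_weights le P \<Longrightarrow> {p. \<alpha> p \<noteq> 0} \<in> nchains le P"
  by (simp add: chain_weights_def)

lemma chain_weights_mem: "\<lbrakk>\<alpha> \<in> chain_weights le P; \<alpha> p \<noteq> 0\<rbrakk> \<Longrightarrow> p \<in> P"
  by (auto simp: chain_weights_def nchains_def)

lemma chain_weights_mono: "P \<subseteq> Q \<Longrightarrow> chain_weights le P \<subseteq> chain_weights le Q"
  by (auto simp: chain_weights_def nchains_def)

lemma chain_weights_le1:
  assumes "finite P" "\<alpha> \<in> chain_weights le P"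
  shows "\<alpha> p \<le> 1"
proof (cases "p \<in> P")
  case True
  then show ?thesis
    using assms member_le_sum[of p P \<alpha>] by (auto simp: chain_weights_iff)
qed (use assms in \<open>force simp: chain_weights_iff\<close>)

lemma closed_coord_eq0: "closed {\<alpha> :: 'p \<Rightarrow> real. \<alpha> p = 0}"
  by (rule closed_Collect_eq) (auto intro: continuous_on_const)

text \<open>That the support is a chain is a closed condition: for each incomparable pair, one of
  the two coordinates vanishes.\<close>

lemma closed_chain_weights:
  assumes "finite P"
  shows "closed (chain_weights le P)"
proof -
  let ?nonadj = "{(p, q). \<not> (le p q \<or> le q p)}"
  have eq: "chain_weights le P = (\<Inter>p. {\<alpha>. 0 \<le> \<alpha> p}) \<inter> (\<Inter>p\<in>-P. {\<alpha>. \<alpha> p = 0}) \<inter>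
    (\<Inter>(p, q)\<in>?nonadj. {\<alpha>. \<alpha> p = 0} \<union> {\<alpha>. \<alpha> q = 0}) \<inter> {\<alpha>. sum \<alpha> P = 1}"
    unfolding set_eq_iff chain_weights_iff[OF assms] by blast
  have "closed {\<alpha> :: 'a \<Rightarrow> real. 0 \<le> \<alpha> p}" for p
    by (rule closed_Collect_le) (auto intro: continuous_on_const)
  moreover have "closed {\<alpha> :: 'a \<Rightarrow> real. sum \<alpha> P = 1}"
    by (rule closed_Collect_eq) (auto intro: continuous_on_sum continuous_on_const)
  moreover have "closed ({\<alpha> :: 'a \<Rightarrow> real. \<alpha> p = 0} \<union> {\<alpha>. \<alpha> q = 0})" for p q
    by (intro closed_Un closed_coord_eq0)
  ultimately show ?thesis
    unfolding eq using closed_coord_eq0 by (intro closed_Int closed_INT ballI) auto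
qed

lemma compact_chain_weights:
  assumes "finite P"
  shows "compact (chain_weights le P)"
proof -
  \<comment> \<open>Tychonoff's theorem: the coordinates are indexed by the whole type, which may be
    infinite although P is finite.\<close>
  have "compactin (powertop_real UNIV) (Pi\<^sub>E UNIV (\<lambda>_ :: 'a. {0..1}))"
    by (simp add: compactin_PiE compactin_euclidean_iff)
  then have "compact (Pi\<^sub>E UNIV (\<lambda>_ :: 'a. {0..1 :: real}))"
    by (simp add: euclidean_product_topology compactin_euclidean_iff)
  then have "compact (chain_weights le P \<inter> Pi\<^sub>E UNIV (\<lambda>_. {0..1}))"
    using closed_chain_weights[OF assms] by (rule closed_Int_compact[rotated])
  moreover have "chain_weights le P \<subseteq> Pi\<^sub>E UNIV (\<lambda>_. {0..1})"
    using chain_weights_le1[OF assms] by (auto simp: chain_weights_def)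
  ultimately show ?thesis
    by (simp add: Int_absorb2)
qed

text \<open>When all maps of the diagram are inclusions, the second component \<open>(\<alpha>, x)\<close> of a
  representative is a complete invariant of a point of the homotopy colimit, and these pairs form
  the following set.\<close>

definition realization :: "('p, 'x) diagram \<Rightarrow> (('p \<Rightarrow> real) \<times> 'x) set" where
  "realization D = {(\<alpha>, x). \<alpha> \<in> chain_weights (leq D) (objs D) \<and>
                            (\<forall>p. \<alpha> p \<noteq> 0 \<longrightarrow> x \<in> topspace (sp D p))}"

text \<open>The chosen representative does not matter when gluing changes only the chain component,
  as it does for diagrams of inclusions.\<close>

definition hocolim_pt :: "('p set \<times> (('p \<Rightarrow> real) \<times> 'x)) set \<Rightarrow> ('p \<Rightarrow> real) \<times> 'x" where
  "hocolim_pt K = snd (SOME z. z \<in> K)"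

abbreviation hocolim_sum :: "('p, 'x) diagram \<Rightarrow> ('p set \<times> (('p \<Rightarrow> real) \<times> 'x)) topology" where
  "hocolim_sum D \<equiv> sum_topology (sp (hocolim_diagram D)) (objs (hocolim_diagram D))"

locale finite_poset =
  fixes le :: "'p \<Rightarrow> 'p \<Rightarrow> bool" and P :: "'p set"
  assumes finite: "finite P"
    and refl: "p \<in> P \<Longrightarrow> le p p"
    and antisym: "\<lbrakk>p \<in> P; q \<in> P; le p q; le q p\<rbrakk> \<Longrightarrow> p = q"
    and trans: "\<lbrakk>p \<in> P; q \<in> P; r \<in> P; le p q; le q r\<rbrakk> \<Longrightarrow> le p r"
begin

lemma ex_chain_max:
  assumes "c \<in> nchains le P"
  shows "\<exists>m\<in>c. \<forall>q\<in>c. le q m"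
proof -
  have "finite c" "c \<noteq> {}" "c \<subseteq> P" "\<forall>x\<in>c. \<forall>y\<in>c. le x y \<or> le y x"
    using assms by (auto simp: nchains_def)
  then show ?thesis
  proof (induction c rule: finite_ne_induct)
    case (singleton x)
    then show ?case using refl by auto
  next
    case (insert x c)
    then obtain m where m: "m \<in> c" "\<forall>q\<in>c. le q m" by auto
    then consider "le x m" | "le m x" using insert.prems by blast
    then show ?case
    proof cases
      case 1
      then show ?thesis using m by auto
    next
      case 2
      then have "\<forall>q\<in>insert x c. le q x"
        using m insert.prems refl trans by (metis insert_iff subset_iff)
      then show ?thesis by blast
    qed
  qed
qed

lemma chain_max_eqI:
  assumes "c \<subseteq> P" "m \<in> c" "\<And>q. q \<in> c \<Longrightarrow> le q m"
  shows "chain_max le c = m"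
  unfolding chain_max_def
proof (rule the_equality)
  fix x assume "x \<in> c \<and> (\<forall>y\<in>c. le y x)"
  then show "x = m" using assms antisym[of x m] by blast
qed (use assms in blast)

lemma chain_max:
  assumes "c \<in> nchains le P"
  shows "chain_max le c \<in> c" "q \<in> c \<Longrightarrow> le q (chain_max le c)" "chain_max le c \<in> P"
proof -
  have "c \<subseteq> P" using assms by (simp add: nchains_def)
  obtain m where m: "m \<in> c" "\<forall>q\<in>c. le q m" using ex_chain_max[OF assms] by blast
  then have "chain_max le c = m" using \<open>c \<subseteq> P\<close> by (intro chain_max_eqI) auto
  then show "chain_max le c \<in> c" "q \<in> c \<Longrightarrow> le q (chain_max le c)" "chain_max le c \<in> P"
    using m \<open>c \<subseteq> P\<close> by auto
qed

end

lemma finite_poset_dual: "finite_poset le P \<Longrightarrow> finite_poset (\<lambda>x y. le y x) P"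
  unfolding finite_poset_def by blast

lemma chain_min_eq_max: "chain_min le = chain_max (\<lambda>x y. le y x)"
  by (simp add: chain_min_def chain_max_def fun_eq_iff)

lemma nchains_dual: "nchains (\<lambda>x y. le y x) P = nchains le P"
  by (auto simp: nchains_def)

context finite_poset
begin

lemma chain_min_eqI:
  assumes "c \<subseteq> P" "m \<in> c" "\<And>q. q \<in> c \<Longrightarrow> le m q"
  shows "chain_min le c = m"
  using finite_poset.chain_max_eqI[OF finite_poset_dual[OF finite_poset_axioms]] assms
  by (simp add: chain_min_eq_max)

lemma chain_min:
  assumes "c \<in> nchains le P"
  shows "chain_min le c \<in> c" "q \<in> c \<Longrightarrow> le (chain_min le c) q" "chain_min le c \<in> P"
proof -
  interpret dual: finite_poset "\<lambda>x y. le y x" P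
    by (rule finite_poset_dual[OF finite_poset_axioms])
  have "c \<in> nchains (\<lambda>x y. le y x) P" by (subst nchains_dual) (rule assms)
  then show "chain_min le c \<in> c" "q \<in> c \<Longrightarrow> le (chain_min le c) q" "chain_min le c \<in> P"
    unfolding chain_min_eq_max using dual.chain_max(1,3)[of c] dual.chain_max(2)[of c q] by simp_all
qed

lemma chain_min_le_max: "c \<in> nchains le P \<Longrightarrow> le (chain_min le c) (chain_max le c)"
  by (simp add: chain_min chain_max)

lemma singleton_nchain: "p \<in> P \<Longrightarrow> {p} \<in> nchains le P"
  by (simp add: nchains_def refl)

lemma chain_max_singleton [simp]: "p \<in> P \<Longrightarrow> chain_max le {p} = p"
  by (rule chain_max_eqI) (auto simp: refl)

lemma chain_min_singleton [simp]: "p \<in> P \<Longrightarrow> chain_min le {p} = p"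
  by (rule chain_min_eqI) (auto simp: refl)

lemma finite_poset_nchains: "finite_poset (\<subseteq>) (nchains le P)"
proof
  have "nchains le P \<subseteq> Pow P" by (auto simp: nchains_def)
  then show "finite (nchains le P)" using finite by (simp add: finite_subset)
qed auto

end

section \<open>Homotopy colimits of inclusions\<close>

text \<open>Keeps membership in a coproduct in the form that \<open>mem_hocolim_sum\<close>
  rewrites.\<close>

declare topspace_sum_topology [simp del]

text \<open>All spaces sit in one ambient space and shrink as the index grows, because arrows go
  down the order. Closedness is what later makes the passage from representatives to pairs a closed
  map.\<close>

locale inclusion_diagram = finite_poset "leq D" "objs D"
  for D :: "('p, 'x::topological_space) diagram" +
  assumes sp_eq: "p \<in> objs D \<Longrightarrow> sp D p = top_of_set (topspace (sp D p))"
    and closed_sp: "p \<in> objs D \<Longrightarrow> closed (topspace (sp D p))"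
    and sp_antimono: "\<lbrakk>p \<in> objs D; q \<in> objs D; leq D p q\<rbrakk> \<Longrightarrow> topspace (sp D q) \<subseteq> topspace (sp D p)"
    and arr_id: "arr D p q = id"
begin

lemma mem_hocolim_sum:
  "(c, (\<alpha>, x)) \<in> topspace (hocolim_sum D) \<longleftrightarrow>
     c \<in> nchains (leq D) (objs D) \<and>
     \<alpha> \<in> chain_weights (leq D) {y \<in> objs D. leq D y (chain_min (leq D) c)} \<and>
     x \<in> topspace (sp D (chain_max (leq D) c))"
  by (auto simp: topspace_sum_topology hocolim_diagram_def order_complex_eq)

text \<open>Spaces shrink upwards, so the largest vertex of the support imposes the strongest
  condition on x.\<close>

lemma realization_iff:
  "(\<alpha>, x) \<in> realization D \<longleftrightarrow> \<alpha> \<in> chain_weights (leq D) (objs D) \<and>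
     x \<in> topspace (sp D (chain_max (leq D) {p. \<alpha> p \<noteq> 0}))"
proof (cases "\<alpha> \<in> chain_weights (leq D) (objs D)")
  case True
  then have c: "{p. \<alpha> p \<noteq> 0} \<in> nchains (leq D) (objs D)" by (rule chain_weights_supp)
  then have "{p. \<alpha> p \<noteq> 0} \<subseteq> objs D" by (simp add: nchains_def)
  moreover have "topspace (sp D (chain_max (leq D) {p. \<alpha> p \<noteq> 0})) \<subseteq> topspace (sp D p)" if "\<alpha> p \<noteq> 0" for p
    using that c calculation by (intro sp_antimono chain_max) auto
  ultimately show ?thesis
    using True chain_max[OF c] by (auto simp: realization_def)
qed (simp add: realization_def)

text \<open>The support of \<alpha> lies below the minimum of c, hence below its maximum, whose
  space contains x and is contained in the spaces of all vertices of the support.\<close>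

lemma hocolim_sum_realization:
  assumes "z \<in> topspace (hocolim_sum D)"
  shows "snd z \<in> realization D"
proof -
  obtain c \<alpha> x where z: "z = (c, (\<alpha>, x))" by (cases z)
  let ?s = "{p. \<alpha> p \<noteq> 0}" and ?m = "chain_min (leq D) c" and ?M = "chain_max (leq D) c"
  have c: "c \<in> nchains (leq D) (objs D)" and x: "x \<in> topspace (sp D ?M)"
    and \<alpha>: "\<alpha> \<in> chain_weights (leq D) {y \<in> objs D. leq D y ?m}"
    using assms by (simp_all add: z mem_hocolim_sum)
  have s: "?s \<subseteq> {y \<in> objs D. leq D y ?m}"
    using chain_weights_supp[OF \<alpha>] by (simp add: nchains_def)
  have \<alpha>': "\<alpha> \<in> chain_weights (leq D) (objs D)"
    using \<alpha> chain_weights_mono[of "{y \<in> objs D. leq D y ?m}" "objs D"] by auto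
  have "leq D p ?M" if "\<alpha> p \<noteq> 0" for p
    using s that trans[of p ?m ?M] chain_min_le_max[OF c] chain_min[OF c] chain_max[OF c] by blast
  then have "x \<in> topspace (sp D p)" if "\<alpha> p \<noteq> 0" for p
    using s that sp_antimono[of p ?M] chain_max[OF c] x by blast
  then show ?thesis
    using \<alpha>' by (simp add: z realization_def)
qed

text \<open>Every admissible pair has a representative over a one-element chain: the top vertex of
  the support bounds the support and has the smallest space that x must lie in.\<close>

lemma canonical_in_hocolim_sum:
  assumes "(\<alpha>, x) \<in> realization D"
  shows "({chain_max (leq D) {p. \<alpha> p \<noteq> 0}}, (\<alpha>, x)) \<in> topspace (hocolim_sum D)"
proof -
  let ?s = "{p. \<alpha> p \<noteq> 0}" and ?m = "chain_max (leq D) {p. \<alpha> p \<noteq> 0}"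
  have \<alpha>: "\<alpha> \<in> chain_weights (leq D) (objs D)" and x: "x \<in> topspace (sp D ?m)"
    using assms by (simp_all add: realization_iff)
  have s: "?s \<in> nchains (leq D) (objs D)" using \<alpha> by (rule chain_weights_supp)
  then have "?s \<in> nchains (leq D) {y \<in> objs D. leq D y ?m}"
    using chain_max[OF s] by (auto simp: nchains_def)
  then have "\<alpha> \<in> chain_weights (leq D) {y \<in> objs D. leq D y ?m}"
    using \<alpha> by (simp add: chain_weights_def)
  then show ?thesis
    using x chain_max(3)[OF s] by (simp add: mem_hocolim_sum singleton_nchain)
qed

section \<open>The equivalence relation of the homotopy colimit\<close>

lemma glue_iff:
  "glue (hocolim_diagram D) (c, (\<alpha>, x)) w \<longleftrightarrow>
    (c, (\<alpha>, x)) \<in> topspace (hocolim_sum D) \<and> snd w = (\<alpha>, x) \<and> fst w \<subseteq> c \<and>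
    fst w \<in> nchains (leq D) (objs D)"
  by (cases w) (auto simp: glue_def mem_hocolim_sum, auto simp: hocolim_diagram_def arr_id order_complex_eq)

lemma equivclp_glue_snd: "equivclp (glue (hocolim_diagram D)) z w \<Longrightarrow> snd z = snd w"
proof (induction rule: equivclp_induct)
  case (step y w)
  have "snd a = snd b" if "glue (hocolim_diagram D) a b" for a b
    using that by (cases a; cases "snd a") (auto simp: glue_iff)
  then show ?case using step by metis
qed simp

text \<open>The top vertex m of the support lies below the minimum of c, so c can be prolonged
  downwards by m. The prolonged chain has the same maximum, still carries (\<alpha>, x), and is
  glued both to c and to {m}.\<close>

lemma equivclp_glue_canonical:
  assumes z: "(c, (\<alpha>, x)) \<in> topspace (hocolim_sum D)"
  shows "equivclp (glue (hocolim_diagram D)) (c, (\<alpha>, x)) ({chain_max (leq D) {p. \<alpha> p \<noteq> 0}}, (\<alpha>, x))"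
proof -
  let ?s = "{p. \<alpha> p \<noteq> 0}"
  let ?m = "chain_max (leq D) ?s" and ?k = "chain_min (leq D) c" and ?M = "chain_max (leq D) c"
  have c: "c \<in> nchains (leq D) (objs D)" and x: "x \<in> topspace (sp D ?M)"
    and \<alpha>: "\<alpha> \<in> chain_weights (leq D) {y \<in> objs D. leq D y ?k}"
    using z by (simp_all add: mem_hocolim_sum)
  have can: "({?m}, (\<alpha>, x)) \<in> topspace (hocolim_sum D)"
    using canonical_in_hocolim_sum hocolim_sum_realization[OF z] by simp
  have s: "?s \<in> nchains (leq D) (objs D)"
    using chain_weights_supp[OF \<alpha>] by (auto simp: nchains_def)
  have m: "?m \<in> objs D" using chain_max[OF s] by simp
  have "?s \<subseteq> {y \<in> objs D. leq D y ?k}"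
    using chain_weights_supp[OF \<alpha>] by (simp add: nchains_def)
  then have mk: "leq D ?m ?k"
    using chain_max(1)[OF s] by blast
  have mc: "leq D ?m q" if "q \<in> c" for q
    using trans[of ?m ?k q] mk m chain_min[OF c] that c by (auto simp: nchains_def)
  have c': "insert ?m c \<in> nchains (leq D) (objs D)"
    using c m mc refl by (auto simp: nchains_def)
  have sub: "insert ?m c \<subseteq> objs D" using c' by (simp add: nchains_def)
  have "chain_max (leq D) (insert ?m c) = ?M"
    using sub chain_max[OF c] mc by (intro chain_max_eqI) auto
  moreover have "chain_min (leq D) (insert ?m c) = ?m"
    using sub mc refl[OF m] by (intro chain_min_eqI) auto
  ultimately have z': "(insert ?m c, (\<alpha>, x)) \<in> topspace (hocolim_sum D)"
    using can c' x m by (simp add: mem_hocolim_sum)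
  have "glue (hocolim_diagram D) (insert ?m c, (\<alpha>, x)) (c, (\<alpha>, x))"
    "glue (hocolim_diagram D) (insert ?m c, (\<alpha>, x)) ({?m}, (\<alpha>, x))"
    using z' c m by (auto simp: glue_iff singleton_nchain)
  then show ?thesis
    by (meson equivclp_sym equivclp_trans r_into_equivclp)
qed

lemma colim_eqv_iff:
  "(z, w) \<in> colim_eqv (hocolim_diagram D) \<longleftrightarrow>
    z \<in> topspace (hocolim_sum D) \<and> w \<in> topspace (hocolim_sum D) \<and> snd z = snd w"
proof -
  let ?can = "\<lambda>\<alpha>x. ({chain_max (leq D) {p. fst \<alpha>x p \<noteq> 0}}, \<alpha>x)"
  have can: "equivclp (glue (hocolim_diagram D)) v (?can (snd v))" if "v \<in> topspace (hocolim_sum D)" for v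
  proof -
    obtain c \<alpha> x where "v = (c, (\<alpha>, x))" by (metis surj_pair)
    then show ?thesis using equivclp_glue_canonical that by simp
  qed
  have "equivclp (glue (hocolim_diagram D)) z w"
    if "z \<in> topspace (hocolim_sum D)" "w \<in> topspace (hocolim_sum D)" "snd z = snd w"
  proof (rule equivclp_trans)
    show "equivclp (glue (hocolim_diagram D)) z (?can (snd z))" using can that(1) .
    show "equivclp (glue (hocolim_diagram D)) (?can (snd z)) w"
      unfolding that(3) using can[OF that(2)] by (rule equivclp_sym)
  qed
  then show ?thesis
    using equivclp_glue_snd[of z w] by (auto simp: colim_eqv_def)
qed

lemma closed_realization: "closed (realization D)"
proof -
  have eq: "realization D = fst -` chain_weights (leq D) (objs D) \<inter>
     (\<Inter>p\<in>objs D. {z. fst z p = 0} \<union> snd -` topspace (sp D p))"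
    using chain_weights_mem by (fastforce simp: realization_def)
  have "closed {z :: ('p \<Rightarrow> real) \<times> 'x. fst z p = 0}" for p
  proof -
    have "{z :: ('p \<Rightarrow> real) \<times> 'x. fst z p = 0} = fst -` {\<alpha>. \<alpha> p = 0}" by auto
    then show ?thesis using closed_vimage_fst[OF closed_coord_eq0] by metis
  qed
  then show ?thesis
    unfolding eq using closed_sp
    by (intro closed_Int closed_INT closed_Un closed_vimage_fst closed_vimage_snd ballI
        closed_chain_weights finite) auto
qed

text \<open>The coproduct has finitely many summands, each a closed subset of the realization.
  Forgetting the chain is therefore a continuous closed surjection, hence a quotient map.\<close>

lemma quotient_map_snd_hocolim_sum: "quotient_map (hocolim_sum D) (top_of_set (realization D)) snd"
proof (rule continuous_closed_imp_quotient_map)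
  let ?S = "\<lambda>c. chain_weights (leq D) {y \<in> objs D. leq D y (chain_min (leq D) c)}
                \<times> topspace (sp D (chain_max (leq D) c))"
  have comp: "sp (hocolim_diagram D) c = top_of_set (?S c)" "closed (?S c)" "?S c \<subseteq> realization D"
    if "c \<in> nchains (leq D) (objs D)" for c
  proof -
    have "sp (hocolim_diagram D) c =
        prod_topology (top_of_set (chain_weights (leq D) {y \<in> objs D. leq D y (chain_min (leq D) c)}))
                      (sp D (chain_max (leq D) c))"
      by (simp add: hocolim_diagram_def order_complex_eq)
    also have "\<dots> = top_of_set (?S c)"
      by (subst sp_eq) (simp_all add: that chain_max(3) flip: subtopology_Times)
    finally show "sp (hocolim_diagram D) c = top_of_set (?S c)" .
    show "closed (?S c)"
      using finite by (intro closed_Times closed_sp closed_chain_weights chain_max(3) that) auto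
    show "?S c \<subseteq> realization D"
      using hocolim_sum_realization[of "(c, z)" for z] that by (force simp: mem_hocolim_sum)
  qed
  have objs: "objs (hocolim_diagram D) = nchains (leq D) (objs D)" by (simp add: hocolim_diagram_def)
  show "snd ` topspace (hocolim_sum D) = topspace (top_of_set (realization D))"
  proof (intro equalityI subsetI)
    fix z assume "z \<in> topspace (top_of_set (realization D))"
    then show "z \<in> snd ` topspace (hocolim_sum D)"
      using canonical_in_hocolim_sum[of "fst z" "snd z"] by (force)
  qed (use hocolim_sum_realization in auto)
  show "closed_map (hocolim_sum D) (top_of_set (realization D)) snd"
    unfolding closed_map_def
  proof (intro allI impI)
    fix U assume U: "closedin (hocolim_sum D) U"
    have "snd ` U = (\<Union>c\<in>nchains (leq D) (objs D). {z. (c, z) \<in> U})"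
      using closedin_subset[OF U] by (force simp: topspace_sum_topology objs)
    moreover have "closedin (top_of_set (realization D)) {z. (c, z) \<in> U}"
      if c: "c \<in> nchains (leq D) (objs D)" for c
    proof -
      have "closedin (top_of_set (?S c)) {z. (c, z) \<in> U}"
        using U c by (simp add: closedin_sum_topology objs comp)
      then have "closed {z. (c, z) \<in> U}" "{z. (c, z) \<in> U} \<subseteq> realization D"
        using comp(2,3)[OF c] closedin_closed_trans closedin_imp_subset by blast+
      then show ?thesis by (simp add: closed_subset)
    qed
    ultimately show "closedin (top_of_set (realization D)) (snd ` U)"
      using finite_poset.finite[OF finite_poset_nchains] by (auto intro!: closedin_Union)
  qed
  show "continuous_map (hocolim_sum D) (top_of_set (realization D)) snd"
    unfolding continuous_map_alt
  proof (intro conjI allI impI)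
    show "snd \<in> topspace (hocolim_sum D) \<rightarrow> topspace (top_of_set (realization D))"
      using hocolim_sum_realization by auto
    fix V assume V: "openin (top_of_set (realization D)) V"
    have "openin (sp (hocolim_diagram D) c) {z. (c, z) \<in> snd -` V \<inter> topspace (hocolim_sum D)}"
      if c: "c \<in> nchains (leq D) (objs D)" for c
    proof -
      have "{z. (c, z) \<in> snd -` V \<inter> topspace (hocolim_sum D)} = ?S c \<inter> V"
        using c comp(1)[OF c] by (auto simp: topspace_sum_topology objs)
      then show ?thesis
        using V comp[OF c] by (auto simp: openin_open)
    qed
    then show "openin (hocolim_sum D) (snd -` V \<inter> topspace (hocolim_sum D))"
      by (subst openin_sum_topology) (auto simp: topspace_sum_topology objs)
  qed
qed

section \<open>Pairs as coordinates on the homotopy colimit\<close>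

lemma hocolim_pt_class:
  assumes "z \<in> topspace (hocolim_sum D)"
  shows "hocolim_pt (colim_eqv (hocolim_diagram D) `` {z}) = snd z"
proof -
  let ?K = "colim_eqv (hocolim_diagram D) `` {z}"
  have "z \<in> ?K" using assms by (simp add: colim_eqv_iff)
  then have "(SOME w. w \<in> ?K) \<in> ?K" by (rule someI[of "\<lambda>w. w \<in> ?K"])
  then have "(z, SOME w. w \<in> ?K) \<in> colim_eqv (hocolim_diagram D)" by (simp only: Image_singleton_iff)
  then have "snd z = snd (SOME w. w \<in> ?K)" by (simp only: colim_eqv_iff)
  then show ?thesis unfolding hocolim_pt_def by (rule HOL.sym)
qed

lemma homeomorphic_map_hocolim_pt:
  "homeomorphic_map (hocolim D) (top_of_set (realization D)) hocolim_pt"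
  unfolding hocolim_def colim_def
  by (rule homeomorphic_map_quotient_space[OF equiv_colim_eqv quotient_map_snd_hocolim_sum])
     (simp_all add: colim_eqv_iff hocolim_pt_class)

lemma topspace_hocolim: "topspace (hocolim D) = topspace (hocolim_sum D) // colim_eqv (hocolim_diagram D)"
proof -
  note E = equiv_colim_eqv[of "hocolim_diagram D"]
  have "openin (hocolim D) (topspace (hocolim_sum D) // colim_eqv (hocolim_diagram D))"
    unfolding hocolim_def colim_def openin_quotient_space[OF E] Union_quotient[OF E] by simp
  moreover have "topspace (hocolim D) \<subseteq> topspace (hocolim_sum D) // colim_eqv (hocolim_diagram D)"
    using openin_topspace[of "hocolim D"]
    unfolding hocolim_def colim_def openin_quotient_space[OF E] by (rule conjunct1)
  ultimately show ?thesis by (intro subset_antisym openin_subset)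
qed

lemma hocolim_class_eq:
  assumes "K \<in> topspace (hocolim D)"
  shows "K = {z \<in> topspace (hocolim_sum D). snd z = hocolim_pt K}" "K \<noteq> {}"
proof -
  obtain z where z: "z \<in> topspace (hocolim_sum D)" "K = colim_eqv (hocolim_diagram D) `` {z}"
    using assms unfolding topspace_hocolim by (rule quotientE)
  then show "K = {z \<in> topspace (hocolim_sum D). snd z = hocolim_pt K}"
    unfolding z(2) hocolim_pt_class[OF z(1)] by (auto simp: colim_eqv_iff)
  show "K \<noteq> {}" using z by (auto simp: colim_eqv_iff)
qed

end

text \<open>A class is a full fibre of \<open>snd\<close>. If the second component of f z depends
  only on that of z, then f sends a class into a single class, so f respects the gluing and g
  describes the induced map.\<close>

lemma colim_map_hocolim_pt:
  assumes D: "inclusion_diagram D" and E: "inclusion_diagram E"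
    and f: "\<And>z. z \<in> topspace (hocolim_sum D) \<Longrightarrow>
        f z \<in> topspace (hocolim_sum E) \<and> snd (f z) = g (snd z)"
    and K: "K \<in> topspace (hocolim D)"
  shows "colim_map (hocolim_diagram E) f K \<in> topspace (hocolim E)"
    and "hocolim_pt (colim_map (hocolim_diagram E) f K) = g (hocolim_pt K)"
proof -
  interpret D: inclusion_diagram D by fact
  interpret E: inclusion_diagram E by fact
  obtain z where z: "z \<in> K" using D.hocolim_class_eq(2)[OF K] by blast
  have KS: "w \<in> topspace (hocolim_sum D)" "snd w = hocolim_pt K" if "w \<in> K" for w
    using D.hocolim_class_eq(1)[OF K] that by blast+
  have fK: "f w \<in> topspace (hocolim_sum E)" "snd (f w) = g (hocolim_pt K)" if "w \<in> K" for w
    using f KS[OF that] by auto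
  have "colim_map (hocolim_diagram E) f K = colim_eqv (hocolim_diagram E) `` {f z}"
    unfolding colim_map_def
    using fK z by (auto simp: Image_def E.colim_eqv_iff) (metis surj_pair)
  then show "colim_map (hocolim_diagram E) f K \<in> topspace (hocolim E)"
    "hocolim_pt (colim_map (hocolim_diagram E) f K) = g (hocolim_pt K)"
    using fK[OF z] by (auto simp: E.topspace_hocolim E.hocolim_pt_class quotientI)
qed

section \<open>Barycentric subdivision\<close>

context finite_poset
begin

lemma chain_max_mono:
  assumes "c \<in> nchains le P" "d \<in> nchains le P" "c \<subseteq> d"
  shows "le (chain_max le c) (chain_max le d)"
  using assms chain_max by blast

text \<open>Taking the maximum is monotone from chains under inclusion to the poset, so it carries
  the extreme members of C to the extreme members of the image.\<close>

lemma chain_max_image: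
  assumes C: "C \<in> nchains (\<subseteq>) (nchains le P)"
  shows "chain_max le ` C \<in> nchains le P"
    and "chain_max le (chain_max le ` C) = chain_max le (chain_max (\<subseteq>) C)"
    and "chain_min le (chain_max le ` C) = chain_max le (chain_min (\<subseteq>) C)"
proof -
  interpret B: finite_poset "(\<subseteq>)" "nchains le P" by (rule finite_poset_nchains)
  have sub: "C \<subseteq> nchains le P" using C by (simp add: nchains_def)
  have "finite C" "C \<noteq> {}" "\<And>c d. c \<in> C \<Longrightarrow> d \<in> C \<Longrightarrow> c \<subseteq> d \<or> d \<subseteq> c"
    using C by (auto simp: nchains_def)
  moreover have "le (chain_max le c) (chain_max le d) \<or> le (chain_max le d) (chain_max le c)"
    if "c \<in> C" "d \<in> C" for c d
    using calculation(3)[OF that] chain_max_mono sub that by blast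
  ultimately show 1: "chain_max le ` C \<in> nchains le P"
    unfolding nchains_def[of le] using sub chain_max(3) by auto
  have sub': "chain_max le ` C \<subseteq> P" using 1 by (simp add: nchains_def)
  show "chain_max le (chain_max le ` C) = chain_max le (chain_max (\<subseteq>) C)"
    using sub B.chain_max[OF C] by (intro chain_max_eqI sub') (auto intro: chain_max_mono)
  show "chain_min le (chain_max le ` C) = chain_max le (chain_min (\<subseteq>) C)"
    using sub B.chain_min[OF C] by (intro chain_min_eqI sub') (auto intro: chain_max_mono)
qed

end

lemma Bd_simps [simp]:
  "objs (Bd D) = nchains (leq D) (objs D)" "leq (Bd D) = (\<subseteq>)"
  "sp (Bd D) c = sp D (chain_max (leq D) c)"
  "arr (Bd D) c d = arr D (chain_max (leq D) c) (chain_max (leq D) d)"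
  by (simp_all add: Bd_def)

lemma inclusion_diagram_Bd:
  assumes "inclusion_diagram D"
  shows "inclusion_diagram (Bd D)"
proof -
  interpret inclusion_diagram D by fact
  show ?thesis
    using finite_poset_nchains sp_eq closed_sp sp_antimono chain_max chain_max_mono
    by (auto simp: inclusion_diagram_def inclusion_diagram_axioms_def arr_id)
qed

section \<open>Barycentric and pushed-forward coordinates\<close>

lemma bary_eq:
  assumes "finite F" "{c. \<alpha> c \<noteq> 0} \<subseteq> F"
  shows "bary \<alpha> x = (\<Sum>c\<in>F. if x \<in> c then \<alpha> c / card c else 0)"
  unfolding bary_def using assms by (intro sum.mono_neutral_cong_left) auto

lemma push_coords_eq:
  assumes "finite F" "{p. \<alpha> p \<noteq> 0} \<subseteq> F"
  shows "push_coords \<phi> \<alpha> q = (\<Sum>p\<in>F. if \<phi> p = q then \<alpha> p else 0)"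
  unfolding push_coords_def using assms by (intro sum.mono_neutral_cong_left) auto

lemma bary_nonzeroD: "bary \<alpha> p \<noteq> 0 \<Longrightarrow> \<exists>c. \<alpha> c \<noteq> 0 \<and> p \<in> c"
  unfolding bary_def
  by (metis (mono_tags, lifting) mem_Collect_eq sum.not_neutral_contains_not_neutral)

lemma push_coords_nonzeroD: "push_coords \<phi> \<alpha> q \<noteq> 0 \<Longrightarrow> \<exists>p. \<alpha> p \<noteq> 0 \<and> \<phi> p = q"
  unfolding push_coords_def
  by (metis (mono_tags, lifting) mem_Collect_eq sum.not_neutral_contains_not_neutral)

text \<open>Each c hands out its weight in \<open>card c\<close> equal shares, all of which land in
  Q; exchanging the two sums collects them again.\<close>

lemma sum_bary:
  assumes F: "finite F" "{c. \<alpha> c \<noteq> 0} \<subseteq> F" and Q: "finite Q"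
    and sub: "\<And>c. \<alpha> c \<noteq> 0 \<Longrightarrow> c \<subseteq> Q \<and> c \<noteq> {}"
  shows "sum (bary \<alpha>) Q = sum \<alpha> F"
proof -
  have "sum (bary \<alpha>) Q = (\<Sum>c\<in>F. \<Sum>p\<in>Q. if p \<in> c then \<alpha> c / card c else 0)"
    by (simp add: bary_eq[OF F] sum.swap[of _ _ Q])
  also have "\<dots> = sum \<alpha> F"
  proof (rule sum.cong)
    fix c assume "c \<in> F"
    show "(\<Sum>p\<in>Q. if p \<in> c then \<alpha> c / card c else 0) = \<alpha> c"
    proof (cases "\<alpha> c = 0")
      case False
      then have c: "c \<subseteq> Q" "c \<noteq> {}" using sub by auto
      then have "Q \<inter> c = c" "card c \<noteq> 0" using Q by (auto simp: finite_subset)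
      then show ?thesis using Q by (simp flip: sum.inter_restrict)
    qed (auto intro: sum.neutral)
  qed simp
  finally show ?thesis .
qed

text \<open>All chains with nonzero weight lie in s, so the new weights are supported on subsets of
  the chain s and comparability is inherited from it. In the application s is the smallest chain of
  a chain of chains.\<close>

lemma (in finite_poset) bary_chain_weights:
  assumes s: "s \<in> nchains le P" and \<alpha>: "\<alpha> \<in> chain_weights (\<subseteq>) {c \<in> nchains le P. c \<subseteq> s}"
  shows "bary \<alpha> \<in> chain_weights le {p \<in> P. le p (chain_max le s)}"
proof -
  let ?F = "{c \<in> nchains le P. c \<subseteq> s}" and ?Q = "{p \<in> P. le p (chain_max le s)}"
  have F: "finite ?F" using finite_poset.finite[OF finite_poset_nchains] by simp
  have Q: "finite ?Q" using finite by simp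
  have c: "c \<in> nchains le P" "c \<subseteq> s" if "\<alpha> c \<noteq> 0" for c
    using chain_weights_mem[OF \<alpha> that] by auto
  have sQ: "s \<subseteq> ?Q" using chain_max[OF s] s by (auto simp: nchains_def)
  have cQ: "c \<subseteq> ?Q" "c \<noteq> {}" if "\<alpha> c \<noteq> 0" for c
    using c[OF that] sQ by (auto simp: nchains_def)
  have "0 \<le> bary \<alpha> p" for p
    using \<alpha> unfolding bary_def by (intro sum_nonneg) (simp add: chain_weights_def)
  moreover have ps: "p \<in> s" if "bary \<alpha> p \<noteq> 0" for p
  proof -
    from bary_nonzeroD[OF that] obtain d where "\<alpha> d \<noteq> 0" "p \<in> d" by blast
    then show ?thesis using c by blast
  qed
  moreover have "le p q \<or> le q p" if "bary \<alpha> p \<noteq> 0" "bary \<alpha> q \<noteq> 0" for p q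
    using ps that s by (auto simp: nchains_def)
  moreover have "sum (bary \<alpha>) ?Q = 1"
    using sum_bary[of ?F \<alpha> ?Q] F Q c cQ \<alpha> by (auto simp: chain_weights_iff)
  ultimately show ?thesis
    using sQ unfolding chain_weights_iff[OF Q] by blast
qed

lemma push_coords_chain_weights:
  assumes P: "finite P" and Q: "finite Q" and \<phi>: "\<phi> ` P \<subseteq> Q"
    and mono: "\<And>p q. \<lbrakk>p \<in> P; q \<in> P; le p q\<rbrakk> \<Longrightarrow> le' (\<phi> p) (\<phi> q)"
    and \<alpha>: "\<alpha> \<in> chain_weights le P"
  shows "push_coords \<phi> \<alpha> \<in> chain_weights le' Q"
proof -
  note mem = chain_weights_mem[OF \<alpha>]
  have "0 \<le> push_coords \<phi> \<alpha> q" for q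
    using \<alpha> unfolding push_coords_def by (intro sum_nonneg) (simp add: chain_weights_def)
  moreover have "q \<in> Q" if "push_coords \<phi> \<alpha> q \<noteq> 0" for q
  proof -
    from push_coords_nonzeroD[OF that] obtain p where "\<alpha> p \<noteq> 0" "\<phi> p = q" by blast
    then show ?thesis using mem \<phi> by blast
  qed
  moreover have "le' q r \<or> le' r q" if qr: "push_coords \<phi> \<alpha> q \<noteq> 0" "push_coords \<phi> \<alpha> r \<noteq> 0" for q r
  proof -
    from push_coords_nonzeroD[OF qr(1)] obtain p where p: "\<alpha> p \<noteq> 0" "\<phi> p = q" by blast
    from push_coords_nonzeroD[OF qr(2)] obtain p' where p': "\<alpha> p' \<noteq> 0" "\<phi> p' = r" by blast
    from p p' have "le p p' \<or> le p' p" using \<alpha> by (simp add: chain_weights_iff[OF P])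
    then show ?thesis using mono mem p p' by blast
  qed
  moreover have "sum (push_coords \<phi> \<alpha>) Q = 1"
  proof -
    have "{p. \<alpha> p \<noteq> 0} \<subseteq> P" using mem by auto
    then have "sum (push_coords \<phi> \<alpha>) Q = (\<Sum>q\<in>Q. \<Sum>p\<in>P. if \<phi> p = q then \<alpha> p else 0)"
      by (intro sum.cong HOL.refl push_coords_eq P)
    also have "\<dots> = (\<Sum>p\<in>P. \<Sum>q\<in>Q. if \<phi> p = q then \<alpha> p else 0)"
      by (rule sum.swap)
    also have "\<dots> = sum \<alpha> P"
      using Q \<phi> by (intro sum.cong) auto
    finally show ?thesis using \<alpha> by (simp add: chain_weights_iff[OF P])
  qed
  ultimately show ?thesis by (auto simp: chain_weights_iff[OF Q])
qed

lemma push_coords_inj: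
  assumes "inj_on \<phi> P" "\<And>p. \<alpha> p \<noteq> 0 \<Longrightarrow> p \<in> P" "p \<in> P"
  shows "push_coords \<phi> \<alpha> (\<phi> p) = \<alpha> p"
proof -
  have "{p'. \<alpha> p' \<noteq> 0 \<and> \<phi> p' = \<phi> p} = (if \<alpha> p = 0 then {} else {p})"
    using assms by (auto dest: inj_onD)
  then show ?thesis by (simp add: push_coords_def)
qed

text \<open>Naturality of the subdivision map. Injectivity enters twice: distinct chains keep
  distinct images, and a chain keeps its cardinality, so the equal shares stay the same.\<close>

lemma bary_push_coords:
  assumes P: "finite P" and inj: "inj_on \<phi> P" and \<alpha>: "\<And>c. \<alpha> c \<noteq> 0 \<Longrightarrow> c \<subseteq> P"
  shows "bary (push_coords ((`) \<phi>) \<alpha>) = push_coords \<phi> (bary \<alpha>)"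
proof
  fix q
  let ?F = "Pow P"
  have F: "finite ?F" "{c. \<alpha> c \<noteq> 0} \<subseteq> ?F" using P \<alpha> by auto
  have inj': "inj_on ((`) \<phi>) ?F" using inj by (rule inj_on_image_Pow)
  have "{c. push_coords ((`) \<phi>) \<alpha> c \<noteq> 0} \<subseteq> (`) \<phi> ` ?F"
    using F by (auto dest!: push_coords_nonzeroD)
  then have "bary (push_coords ((`) \<phi>) \<alpha>) q =
      (\<Sum>c\<in>?F. if q \<in> \<phi> ` c then push_coords ((`) \<phi>) \<alpha> (\<phi> ` c) / card (\<phi> ` c) else 0)"
    using F(1) inj' by (subst bary_eq[of "(`) \<phi> ` ?F"]) (auto simp: sum.reindex)
  also have "\<dots> = (\<Sum>c\<in>?F. if q \<in> \<phi> ` c then \<alpha> c / card c else 0)"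
  proof (rule sum.cong)
    fix c assume c: "c \<in> ?F"
    have "push_coords ((`) \<phi>) \<alpha> (\<phi> ` c) = \<alpha> c"
      using push_coords_inj[OF inj', of \<alpha> c] c F(2) by blast
    moreover have "card (\<phi> ` c) = card c"
      using inj c by (intro card_image) (auto intro: inj_on_subset)
    ultimately show "(if q \<in> \<phi> ` c then push_coords ((`) \<phi>) \<alpha> (\<phi> ` c) / card (\<phi> ` c) else 0) =
        (if q \<in> \<phi> ` c then \<alpha> c / card c else 0)" by simp
  qed simp
  \<comment> \<open>When q lies in the image of c, the inner sum has exactly one nonzero term, at
    the preimage of q.\<close>
  also have "\<dots> = (\<Sum>c\<in>?F. \<Sum>p\<in>P. if \<phi> p = q \<and> p \<in> c then \<alpha> c / card c else 0)"
  proof (rule sum.cong)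
    fix c assume c: "c \<in> ?F"
    show "(if q \<in> \<phi> ` c then \<alpha> c / card c else 0) =
        (\<Sum>p\<in>P. if \<phi> p = q \<and> p \<in> c then \<alpha> c / card c else 0)"
    proof (cases "q \<in> \<phi> ` c")
      case True
      then obtain p0 where p0: "p0 \<in> c" "q = \<phi> p0" by auto
      have "(\<phi> p = q \<and> p \<in> c) \<longleftrightarrow> p0 = p" if "p \<in> P" for p
        using p0 c that inj by (auto dest: inj_onD)
      then have "(\<Sum>p\<in>P. if \<phi> p = q \<and> p \<in> c then \<alpha> c / card c else 0) =
          (\<Sum>p\<in>P. if p0 = p then \<alpha> c / card c else 0)"
        by (intro sum.cong) auto
      then show ?thesis using True P p0 c by auto
    next
      case False
      then have "(\<Sum>p\<in>P. if \<phi> p = q \<and> p \<in> c then \<alpha> c / card c else 0) = 0"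
        by (intro sum.neutral) auto
      then show ?thesis using False by simp
    qed
  qed simp
  also have "\<dots> = (\<Sum>p\<in>P. if \<phi> p = q then bary \<alpha> p else 0)"
    by (subst sum.swap) (auto simp: bary_eq[OF F] intro!: sum.cong)
  also have "\<dots> = push_coords \<phi> (bary \<alpha>) q"
    using P \<alpha> by (subst push_coords_eq[of P]) (auto dest!: bary_nonzeroD)
  finally show "bary (push_coords ((`) \<phi>) \<alpha>) q = push_coords \<phi> (bary \<alpha>) q" .
qed

text \<open>Induction on the support S: the minimum of f on S is subtracted throughout S, which
  leaves a function with strictly smaller support, and the constant part is a multiple of the
  barycenter of S. Every chain found later is a proper subset of S, so comparability persists. The
  total weight is left free because the remainder has smaller total.\<close>

lemma bary_surjective:
  assumes "finite S" "\<And>p. 0 \<le> f p" "{p. f p \<noteq> 0} = S"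
  shows "\<exists>\<alpha>. (\<forall>c. 0 \<le> \<alpha> c) \<and> (\<forall>c. \<alpha> c \<noteq> 0 \<longrightarrow> c \<noteq> {} \<and> c \<subseteq> S) \<and>
    (\<forall>c d. \<alpha> c \<noteq> 0 \<longrightarrow> \<alpha> d \<noteq> 0 \<longrightarrow> c \<subseteq> d \<or> d \<subseteq> c) \<and> bary \<alpha> = f"
  using assms
proof (induction S arbitrary: f rule: finite_psubset_induct)
  case (psubset S)
  show ?case
  proof (cases "S = {}")
    case True
    then have "f = (\<lambda>_. 0)" using psubset.prems by auto
    then show ?thesis by (intro exI[of _ "\<lambda>_. 0"]) (simp add: bary_def fun_eq_iff)
  next
    case False
    define m where "m = Min (f ` S)"
    have m: "m \<in> f ` S" "\<And>p. p \<in> S \<Longrightarrow> m \<le> f p"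
      using False psubset.hyps by (auto simp: m_def)
    have "0 < f p" if "p \<in> S" for p
      using that psubset.prems by (metis (mono_tags) less_eq_real_def mem_Collect_eq)
    then have "0 < m" using m by auto
    define f' where "f' = (\<lambda>p. if p \<in> S then f p - m else 0)"
    have nonneg: "0 \<le> f' p" for p using m by (auto simp: f'_def)
    have "{p. f' p \<noteq> 0} \<subset> S" using m by (auto simp: f'_def)
    from psubset.IH[OF this nonneg HOL.refl] obtain \<alpha> where \<alpha>: "\<forall>c. 0 \<le> \<alpha> c"
      "\<forall>c. \<alpha> c \<noteq> 0 \<longrightarrow> c \<noteq> {} \<and> c \<subseteq> {p. f' p \<noteq> 0}"
      "\<forall>c d. \<alpha> c \<noteq> 0 \<longrightarrow> \<alpha> d \<noteq> 0 \<longrightarrow> c \<subseteq> d \<or> d \<subseteq> c" "bary \<alpha> = f'" by blast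
    have sub: "c \<subset> S" if "\<alpha> c \<noteq> 0" for c
      using \<alpha>(2) that \<open>{p. f' p \<noteq> 0} \<subset> S\<close> by blast
    then have S0: "\<alpha> S = 0" by blast
    \<comment> \<open>\<open>bary\<close> divides the weight of S by \<open>card S\<close>, so this
      weight contributes exactly m at each vertex of S.\<close>
    let ?\<beta> = "\<alpha>(S := m * card S)"
    have "card S \<noteq> 0" using False psubset.hyps by simp
    have "bary ?\<beta> p = f p" for p
    proof -
      have F: "finite (Pow S)" using psubset.hyps by simp
      have "bary ?\<beta> p = (\<Sum>c\<in>Pow S. if p \<in> c then ?\<beta> c / card c else 0)"
        using sub by (intro bary_eq F) (auto split: if_splits)
      also have "\<dots> = (\<Sum>c\<in>Pow S. (if p \<in> c then \<alpha> c / card c else 0) + (if S = c then if p \<in> S then m else 0 else 0))"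
        using S0 \<open>card S \<noteq> 0\<close> by (intro sum.cong) auto
      also have "\<dots> = bary \<alpha> p + (if p \<in> S then m else 0)"
        using F sub by (subst bary_eq[of "Pow S"]) (auto simp: sum.distrib)
      finally show ?thesis
        using \<alpha>(4) psubset.prems(2) by (auto simp: f'_def)
    qed
    then have "bary ?\<beta> = f" by (rule ext)
    moreover have "0 \<le> ?\<beta> c" for c using \<alpha>(1) \<open>0 < m\<close> by simp
    moreover have nz: "c = S \<or> \<alpha> c \<noteq> 0" if "?\<beta> c \<noteq> 0" for c
      using that by (auto split: if_splits)
    moreover have "c \<noteq> {} \<and> c \<subseteq> S" if "?\<beta> c \<noteq> 0" for c
      using nz[OF that] \<alpha>(2) sub False by blast
    moreover have "c \<subseteq> d \<or> d \<subseteq> c" if "?\<beta> c \<noteq> 0" "?\<beta> d \<noteq> 0" for c d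
      using nz[OF that(1)] nz[OF that(2)] \<alpha>(3) sub by blast
    ultimately show ?thesis by blast
  qed
qed

section \<open>The embedding\<close>

lemma hocolim_Bd_map_pt:
  assumes D: "inclusion_diagram D" and K: "K \<in> topspace (hocolim (Bd D))"
  shows "hocolim_Bd_map D K \<in> topspace (hocolim D)"
    and "hocolim_pt (hocolim_Bd_map D K) = map_prod bary id (hocolim_pt K)"
proof -
  interpret inclusion_diagram D by fact
  interpret B: inclusion_diagram "Bd D" by (rule inclusion_diagram_Bd[OF D])
  have "(chain_max (leq D) ` C, (bary \<alpha>, x)) \<in> topspace (hocolim_sum D)"
    if "(C, (\<alpha>, x)) \<in> topspace (hocolim_sum (Bd D))" for C \<alpha> x
  proof -
    have C: "C \<in> nchains (\<subseteq>) (nchains (leq D) (objs D))"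
      and \<alpha>: "\<alpha> \<in> chain_weights (\<subseteq>) {c \<in> nchains (leq D) (objs D). c \<subseteq> chain_min (\<subseteq>) C}"
      and x: "x \<in> topspace (sp D (chain_max (leq D) (chain_max (\<subseteq>) C)))"
      using that by (simp_all add: B.mem_hocolim_sum)
    have "chain_min (\<subseteq>) C \<in> nchains (leq D) (objs D)"
      using B.chain_min(3) C by simp
    then show ?thesis
      using bary_chain_weights[OF _ \<alpha>] x by (simp add: mem_hocolim_sum chain_max_image[OF C])
  qed
  then have f: "(\<lambda>(C, \<alpha>, x). (chain_max (leq D) ` C, bary \<alpha>, x)) z \<in> topspace (hocolim_sum D) \<and>
      snd ((\<lambda>(C, \<alpha>, x). (chain_max (leq D) ` C, bary \<alpha>, x)) z) = map_prod bary id (snd z)"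
    if "z \<in> topspace (hocolim_sum (Bd D))" for z
    using that by (cases z; cases "snd z") auto
  note * = colim_map_hocolim_pt[where f = "\<lambda>(C, \<alpha>, x). (chain_max (leq D) ` C, bary \<alpha>, x)"
      and g = "map_prod bary id", OF inclusion_diagram_Bd[OF D] D f K]
  show "hocolim_Bd_map D K \<in> topspace (hocolim D)"
    "hocolim_pt (hocolim_Bd_map D K) = map_prod bary id (hocolim_pt K)"
    unfolding hocolim_Bd_map_def using * by auto
qed

lemma hocolim_restr_map_pt:
  assumes D: "inclusion_diagram D" and E: "inclusion_diagram E"
    and \<phi>: "\<And>p. p \<in> objs D \<Longrightarrow> \<phi> p \<in> objs E"
    and mono: "\<And>p q. \<lbrakk>p \<in> objs D; q \<in> objs D; leq D p q\<rbrakk> \<Longrightarrow> leq E (\<phi> p) (\<phi> q)"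
    and sp: "\<And>p. p \<in> objs D \<Longrightarrow> sp E (\<phi> p) = sp D p"
    and K: "K \<in> topspace (hocolim D)"
  shows "hocolim_restr_map E \<phi> K \<in> topspace (hocolim E)"
    and "hocolim_pt (hocolim_restr_map E \<phi> K) = map_prod (push_coords \<phi>) id (hocolim_pt K)"
proof -
  interpret D: inclusion_diagram D by fact
  interpret E: inclusion_diagram E by fact
  have "(\<phi> ` c, (push_coords \<phi> \<alpha>, x)) \<in> topspace (hocolim_sum E)"
    if "(c, (\<alpha>, x)) \<in> topspace (hocolim_sum D)" for c \<alpha> x
  proof -
    let ?m = "chain_min (leq D) c" and ?M = "chain_max (leq D) c"
    have c: "c \<in> nchains (leq D) (objs D)"
      and \<alpha>: "\<alpha> \<in> chain_weights (leq D) {p \<in> objs D. leq D p ?m}"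
      and x: "x \<in> topspace (sp D ?M)"
      using that by (simp_all add: D.mem_hocolim_sum)
    have sub: "c \<subseteq> objs D" using c by (simp add: nchains_def)
    then have sub': "\<phi> ` c \<subseteq> objs E" using \<phi> by auto
    have c': "\<phi> ` c \<in> nchains (leq E) (objs E)"
    proof -
      have "leq E (\<phi> p) (\<phi> q) \<or> leq E (\<phi> q) (\<phi> p)" if "p \<in> c" "q \<in> c" for p q
        using c mono that sub unfolding nchains_def by blast
      then show ?thesis using c sub' unfolding nchains_def by auto
    qed
    have M: "chain_max (leq E) (\<phi> ` c) = \<phi> ?M"
      using D.chain_max[OF c] sub by (intro E.chain_max_eqI sub') (auto intro: mono)
    have m: "chain_min (leq E) (\<phi> ` c) = \<phi> ?m"
      using D.chain_min[OF c] sub by (intro E.chain_min_eqI sub') (auto intro: mono)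
    have "push_coords \<phi> \<alpha> \<in> chain_weights (leq E) {q \<in> objs E. leq E q (\<phi> ?m)}"
      using D.finite E.finite D.chain_min(3)[OF c]
      by (intro push_coords_chain_weights[OF _ _ _ _ \<alpha>]) (auto intro: \<phi> mono)
    then show ?thesis
      using c' x D.chain_max(3)[OF c] by (simp add: E.mem_hocolim_sum M m sp)
  qed
  then have f: "(\<lambda>(c, \<alpha>, x). (\<phi> ` c, push_coords \<phi> \<alpha>, x)) z \<in> topspace (hocolim_sum E) \<and>
      snd ((\<lambda>(c, \<alpha>, x). (\<phi> ` c, push_coords \<phi> \<alpha>, x)) z) = map_prod (push_coords \<phi>) id (snd z)"
    if "z \<in> topspace (hocolim_sum D)" for z
    using that by (cases z; cases "snd z") auto
  note * = colim_map_hocolim_pt[where f = "\<lambda>(c, \<alpha>, x). (\<phi> ` c, push_coords \<phi> \<alpha>, x)"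
      and g = "map_prod (push_coords \<phi>) id", OF D E f K]
  show "hocolim_restr_map E \<phi> K \<in> topspace (hocolim E)"
    "hocolim_pt (hocolim_restr_map E \<phi> K) = map_prod (push_coords \<phi>) id (hocolim_pt K)"
    unfolding hocolim_restr_map_def using * by auto
qed

text \<open>Makes the \<open>inv_into\<close> in \<open>ZZ_to_Vassiliev\<close> an actual preimage.
  The weights come from \<open>bary_surjective\<close>; the point x is admissible for them because
  the maximum of each chain used is a vertex of the support of f.\<close>

lemma hocolim_Bd_map_surjective:
  assumes D: "inclusion_diagram D" and K: "K \<in> topspace (hocolim D)"
  shows "K \<in> hocolim_Bd_map D ` topspace (hocolim (Bd D))"
proof -
  interpret inclusion_diagram D by fact
  interpret B: inclusion_diagram "Bd D" by (rule inclusion_diagram_Bd[OF D])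
  note hom = homeomorphic_map_hocolim_pt and homB = B.homeomorphic_map_hocolim_pt
  obtain f x where fx: "hocolim_pt K = (f, x)" by fastforce
  then have r: "(f, x) \<in> realization D"
    using homeomorphic_imp_surjective_map[OF hom] K by force
  let ?s = "{p. f p \<noteq> 0}"
  have f: "f \<in> chain_weights (leq D) (objs D)" using r by (simp add: realization_def)
  have s: "?s \<in> nchains (leq D) (objs D)" using f by (rule chain_weights_supp)
  then have "finite ?s" by (simp add: nchains_def)
  moreover have "0 \<le> f p" for p using f by (simp add: chain_weights_def)
  ultimately obtain \<alpha> where \<alpha>: "\<forall>c. 0 \<le> \<alpha> c" "\<forall>c. \<alpha> c \<noteq> 0 \<longrightarrow> c \<noteq> {} \<and> c \<subseteq> ?s"
    "\<forall>c d. \<alpha> c \<noteq> 0 \<longrightarrow> \<alpha> d \<noteq> 0 \<longrightarrow> c \<subseteq> d \<or> d \<subseteq> c" "bary \<alpha> = f"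
    using bary_surjective by blast
  have c: "c \<in> nchains (leq D) (objs D)" if "\<alpha> c \<noteq> 0" for c
    using \<alpha>(2) that s finite_subset[of c ?s] unfolding nchains_def by blast
  have "sum \<alpha> (nchains (leq D) (objs D)) = sum f (objs D)"
    unfolding \<alpha>(4)[symmetric]
    using B.finite finite c by (intro sum_bary[symmetric]) (auto simp: nchains_def)
  also have "\<dots> = 1" using f by (simp add: chain_weights_iff[OF finite])
  finally have "\<alpha> \<in> chain_weights (\<subseteq>) (nchains (leq D) (objs D))"
    using B.finite \<alpha>(1,3) c by (simp add: chain_weights_iff)
  moreover have "x \<in> topspace (sp D (chain_max (leq D) c))" if "\<alpha> c \<noteq> 0" for c
    using \<alpha>(2) that chain_max(1)[OF c[OF that]] r by (auto simp: realization_def)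
  ultimately have "(\<alpha>, x) \<in> realization (Bd D)"
    by (simp add: realization_def)
  then obtain L where L: "L \<in> topspace (hocolim (Bd D))" "hocolim_pt L = (\<alpha>, x)"
    using homeomorphic_imp_surjective_map[OF homB] by (metis imageE topspace_euclidean_subtopology)
  have "hocolim_pt (hocolim_Bd_map D L) = hocolim_pt K"
    using hocolim_Bd_map_pt(2)[OF D L(1)] by (simp add: L(2) \<alpha>(4) fx)
  then have "hocolim_Bd_map D L = K"
    using homeomorphic_imp_injective_map[OF hom] hocolim_Bd_map_pt(1)[OF D L(1)] K
    by (auto dest: inj_onD)
  then show ?thesis using L(1) by blast
qed

section \<open>The two diagrams of an arrangement\<close>

lemma ZZ_simps [simp]:
  "objs (ZZ \<A>) = intersections \<A>" "leq (ZZ \<A>) = (\<lambda>x y. y \<subseteq> x)"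
  "sp (ZZ \<A>) = (\<lambda>x. top_of_set x)" "arr (ZZ \<A>) = (\<lambda>x y. id)"
  by (simp_all add: ZZ_def)

lemma Vassiliev_simps [simp]:
  "objs (Vassiliev \<A>) = nerve \<A>" "leq (Vassiliev \<A>) = (\<subseteq>)"
  "sp (Vassiliev \<A>) = (\<lambda>\<sigma>. top_of_set (\<Inter>\<sigma>))" "arr (Vassiliev \<A>) = (\<lambda>\<sigma> \<tau>. id)"
  by (simp_all add: Vassiliev_def)

lemma inclusion_diagram_Vassiliev:
  assumes "finite \<A>" "\<And>a. a \<in> \<A> \<Longrightarrow> closed a"
  shows "inclusion_diagram (Vassiliev \<A>)"
proof
  have "nerve \<A> \<subseteq> Pow \<A>" by (auto simp: nerve_def)
  then show "finite (objs (Vassiliev \<A>))" using assms by (simp add: finite_subset)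
qed (use assms in \<open>auto simp: nerve_def intro!: closed_Inter\<close>)

lemma inclusion_diagram_ZZ:
  assumes "finite \<A>" "\<And>a. a \<in> \<A> \<Longrightarrow> closed a"
  shows "inclusion_diagram (ZZ \<A>)"
proof
  have "intersections \<A> \<subseteq> Inter ` Pow \<A>" by (auto simp: intersections_def)
  then show "finite (objs (ZZ \<A>))" using assms finite_subset[of _ "Inter ` Pow \<A>"] by simp
qed (use assms in \<open>auto simp: intersections_def intro!: closed_Inter\<close>)

lemma inj_on_complete_simplex: "inj_on (complete_simplex \<A>) (intersections \<A>)"
  by (metis complete_simplex_props(2) inj_onI)

lemma complete_simplex_antimono: "y \<subseteq> x \<Longrightarrow> complete_simplex \<A> x \<subseteq> complete_simplex \<A> y"
  by (auto simp: complete_simplex_def)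

text \<open>If \<alpha> are the subdivided weights of a preimage, the composite applies
  \<open>bary\<close> after relabelling. By \<open>bary_push_coords\<close> this is the relabelling
  of \<open>bary \<alpha>\<close>, and \<open>bary \<alpha>\<close> are the original
  weights.\<close>

lemma ZZ_to_Vassiliev_pt:
  assumes fin: "finite \<A>" and cl: "\<And>a. a \<in> \<A> \<Longrightarrow> closed a"
    and K: "K \<in> topspace (hocolim (ZZ \<A>))"
  shows "ZZ_to_Vassiliev \<A> K \<in> topspace (hocolim (Vassiliev \<A>))"
    and "hocolim_pt (ZZ_to_Vassiliev \<A> K) =
         map_prod (push_coords (complete_simplex \<A>)) id (hocolim_pt K)"
proof -
  let ?\<kappa> = "complete_simplex \<A>" and ?V = "Vassiliev \<A>"
  have Z: "inclusion_diagram (ZZ \<A>)" and V: "inclusion_diagram ?V"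
    using fin cl by (auto intro: inclusion_diagram_ZZ inclusion_diagram_Vassiliev)
  interpret Z: inclusion_diagram "ZZ \<A>" by (rule Z)
  interpret V: inclusion_diagram ?V by (rule V)
  interpret BZ: inclusion_diagram "Bd (ZZ \<A>)" by (rule inclusion_diagram_Bd[OF Z])
  define L where "L = inv_into (topspace (hocolim (Bd (ZZ \<A>)))) (hocolim_Bd_map (ZZ \<A>)) K"
  have L: "L \<in> topspace (hocolim (Bd (ZZ \<A>)))" "hocolim_Bd_map (ZZ \<A>) L = K"
    unfolding L_def using hocolim_Bd_map_surjective[OF Z K]
    by (simp_all only: inv_into_into f_inv_into_f)
  obtain \<alpha> x where \<alpha>x: "hocolim_pt L = (\<alpha>, x)" by fastforce
  \<comment> \<open>Both orders reverse inclusion of subspaces, so maxima correspond. As the members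
    of \<open>complete_simplex \<A> x\<close> intersect in x, the two subdivided diagrams then have
    the same space at corresponding chains.\<close>
  have chain: "?\<kappa> ` c \<in> nchains (\<subseteq>) (nerve \<A>)" "chain_max (\<subseteq>) (?\<kappa> ` c) = ?\<kappa> (chain_max (leq (ZZ \<A>)) c)"
    if c: "c \<in> nchains (leq (ZZ \<A>)) (intersections \<A>)" for c
  proof -
    have sub: "c \<subseteq> intersections \<A>" using c by (simp add: nchains_def)
    then have sub': "?\<kappa> ` c \<subseteq> nerve \<A>" using complete_simplex_props by blast
    moreover have "?\<kappa> x \<subseteq> ?\<kappa> y \<or> ?\<kappa> y \<subseteq> ?\<kappa> x" if "x \<in> c" "y \<in> c" for x y
    proof -
      have "y \<subseteq> x \<or> x \<subseteq> y" using c that by (simp add: nchains_def)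
      then show ?thesis using complete_simplex_antimono by blast
    qed
    moreover have "finite c" "c \<noteq> {}" using c by (simp_all add: nchains_def)
    ultimately show "?\<kappa> ` c \<in> nchains (\<subseteq>) (nerve \<A>)"
      unfolding nchains_def by auto
    have *: "chain_max (leq (ZZ \<A>)) c \<in> c" "\<And>q. q \<in> c \<Longrightarrow> leq (ZZ \<A>) q (chain_max (leq (ZZ \<A>)) c)"
      using Z.chain_max c by simp_all
    show "chain_max (\<subseteq>) (?\<kappa> ` c) = ?\<kappa> (chain_max (leq (ZZ \<A>)) c)"
    proof (rule V.chain_max_eqI[unfolded Vassiliev_simps])
      fix \<sigma> assume "\<sigma> \<in> ?\<kappa> ` c"
      then obtain x where "x \<in> c" "\<sigma> = ?\<kappa> x" by blast
      then show "\<sigma> \<subseteq> ?\<kappa> (chain_max (leq (ZZ \<A>)) c)"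
        using *(2)[of x] by (simp only: ZZ_simps complete_simplex_antimono)
    qed (use *(1) sub' in auto)
  qed
  let ?M = "hocolim_restr_map (Bd ?V) (\<lambda>c. ?\<kappa> ` c) L"
  have M: "?M \<in> topspace (hocolim (Bd ?V))"
    "hocolim_pt ?M = map_prod (push_coords (\<lambda>c. ?\<kappa> ` c)) id (hocolim_pt L)"
    using L(1) chain
      complete_simplex_props(2)[of "chain_max (leq (ZZ \<A>)) c" for c] Z.chain_max(3)
    by (intro hocolim_restr_map_pt[OF inclusion_diagram_Bd[OF Z] inclusion_diagram_Bd[OF V]]; force)+
  have eq: "ZZ_to_Vassiliev \<A> K = hocolim_Bd_map ?V ?M"
    by (simp add: ZZ_to_Vassiliev_def L_def)
  show "ZZ_to_Vassiliev \<A> K \<in> topspace (hocolim ?V)"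
    unfolding eq by (rule hocolim_Bd_map_pt(1)[OF V M(1)])
  have "(\<alpha>, x) \<in> realization (Bd (ZZ \<A>))"
    using homeomorphic_imp_surjective_map[OF BZ.homeomorphic_map_hocolim_pt] L(1) \<alpha>x by force
  then have "\<alpha> \<in> chain_weights (\<subseteq>) (nchains (leq (ZZ \<A>)) (intersections \<A>))"
    by (simp add: realization_def)
  from chain_weights_mem[OF this] have "c \<subseteq> intersections \<A>" if "\<alpha> c \<noteq> 0" for c
    using that by (auto simp: nchains_def)
  then have "bary (push_coords ((`) ?\<kappa>) \<alpha>) = push_coords ?\<kappa> (bary \<alpha>)"
    using Z.finite inj_on_complete_simplex by (intro bary_push_coords) auto
  then show "hocolim_pt (ZZ_to_Vassiliev \<A> K) = map_prod (push_coords ?\<kappa>) id (hocolim_pt K)"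
    using M hocolim_Bd_map_pt(2)[OF V M(1)] hocolim_Bd_map_pt(2)[OF Z L(1)]
    by (simp add: eq L(2) \<alpha>x)
qed

section \<open>Deformation along a closure operator\<close>

text \<open>For a closure operator \<open>c\<close>, moving all weights from \<open>\<beta>\<close> to \<open>c\<close> along straight lines
  would leave the order complex, since \<open>p < q\<close> does not make \<open>c p\<close> and \<open>q\<close> comparable. So the
  weights are moved from the top down: at time \<open>t\<close> the uppermost mass \<open>t\<close> of the support chain
  has been moved. This is the prism triangulation of the homotopy in coordinates.\<close>

definition mass_above :: "('p \<Rightarrow> 'p \<Rightarrow> bool) \<Rightarrow> 'p set \<Rightarrow> ('p \<Rightarrow> real) \<Rightarrow> 'p \<Rightarrow> real" where
  "mass_above le P \<beta> p = (\<Sum>q | q \<in> P \<and> le p q \<and> q \<noteq> p. \<beta> q)"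

text \<open>Lay the support chain out on [0, 1] from the top down, so that p occupies the interval
  from \<open>mass_above le P \<beta> p\<close> of length \<open>\<beta> p\<close>. The formula is
  the length of the part of this interval that lies in [0, t].\<close>

definition moved_mass :: "('p \<Rightarrow> 'p \<Rightarrow> bool) \<Rightarrow> 'p set \<Rightarrow> real \<Rightarrow> ('p \<Rightarrow> real) \<Rightarrow> 'p \<Rightarrow> real" where
  "moved_mass le P t \<beta> p = min t (\<beta> p + mass_above le P \<beta> p) - min t (mass_above le P \<beta> p)"

definition slide :: "('p \<Rightarrow> 'p \<Rightarrow> bool) \<Rightarrow> 'p set \<Rightarrow> ('p \<Rightarrow> 'p) \<Rightarrow> real \<Rightarrow> ('p \<Rightarrow> real) \<Rightarrow> 'p \<Rightarrow> real" where
  "slide le P c t \<beta> p = \<beta> p - moved_mass le P t \<beta> p +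
     (\<Sum>q\<in>P. if c q = p then moved_mass le P t \<beta> q else 0)"

text \<open>The sums run over index sets independent of the weights, and \<open>min\<close> absorbs
  the case distinction on whether t has reached a vertex, so each coordinate is jointly
  continuous.\<close>

lemma continuous_on_slide:
  fixes P :: "'p set"
  shows "continuous_on S (\<lambda>z. slide le P c (fst z) (snd z))"
proof (rule continuous_on_coordinatewise_then_product)
  fix p
  have coord: "continuous_on S (\<lambda>z. snd z q)" for q :: 'p
    by (rule continuous_on_product_then_coordinatewise[OF continuous_on_snd[OF continuous_on_id]])
  have fst: "continuous_on S fst" by (rule continuous_on_fst[OF continuous_on_id])
  have above: "continuous_on S (\<lambda>z. mass_above le P (snd z) q)" for q
    unfolding mass_above_def by (intro continuous_on_sum coord)
  have moved: "continuous_on S (\<lambda>z. moved_mass le P (fst z) (snd z) q)" for q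
    unfolding moved_mass_def
    by (intro continuous_on_diff continuous_on_min continuous_on_add fst above coord)
  have "continuous_on S (\<lambda>z. if c q = p then moved_mass le P (fst z) (snd z) q else 0)" for q
    using moved by (cases "c q = p") (simp_all add: continuous_on_const)
  then show "continuous_on S (\<lambda>z. slide le P c (fst z) (snd z) p)"
    unfolding slide_def by (intro continuous_on_add continuous_on_diff continuous_on_sum coord moved)
qed

locale closure_operator = finite_poset le P
  for le :: "'p \<Rightarrow> 'p \<Rightarrow> bool" and P :: "'p set" +
  fixes c :: "'p \<Rightarrow> 'p"
  assumes c_in: "p \<in> P \<Longrightarrow> c p \<in> P"
    and c_mono: "\<lbrakk>p \<in> P; q \<in> P; le p q\<rbrakk> \<Longrightarrow> le (c p) (c q)"
    and c_ext: "p \<in> P \<Longrightarrow> le p (c p)"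
    and c_idem: "p \<in> P \<Longrightarrow> c (c p) = c p"
begin

context
  fixes \<beta> :: "'p \<Rightarrow> real"
  assumes \<beta>: "\<beta> \<in> chain_weights le P"
begin

section \<open>Intervals of mass along the support chain\<close>

lemma weight_nonneg: "0 \<le> \<beta> p"
  using \<beta> by (simp add: chain_weights_def)

lemma mass_above_nonneg: "0 \<le> mass_above le P \<beta> p"
  unfolding mass_above_def by (intro sum_nonneg weight_nonneg)

text \<open>Since q and everything strictly above it lie strictly above p, the interval of the
  higher vertex ends before that of the lower one begins.\<close>

lemma mass_above_less:
  assumes "p \<in> P" "q \<in> P" "le p q" "p \<noteq> q"
  shows "\<beta> q + mass_above le P \<beta> q \<le> mass_above le P \<beta> p"
proof -
  let ?A = "\<lambda>p. {r. r \<in> P \<and> le p r \<and> r \<noteq> p}"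
  have "insert q (?A q) \<subseteq> ?A p"
  proof
    fix r assume "r \<in> insert q (?A q)"
    then show "r \<in> ?A p"
      using assms trans[of p q r] antisym[of p q] by auto
  qed
  then have "sum \<beta> (insert q (?A q)) \<le> sum \<beta> (?A p)"
    using finite weight_nonneg by (intro sum_mono2) auto
  then show ?thesis
    using finite by (simp add: mass_above_def)
qed

lemma mass_above_le1:
  assumes "p \<in> P"
  shows "\<beta> p + mass_above le P \<beta> p \<le> 1"
proof -
  have "sum \<beta> (insert p {r. r \<in> P \<and> le p r \<and> r \<noteq> p}) \<le> sum \<beta> P"
    using finite weight_nonneg assms by (intro sum_mono2) auto
  also have "\<dots> = 1" using \<beta> by (simp add: chain_weights_iff[OF finite])
  finally show ?thesis using finite by (simp add: mass_above_def)
qed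

lemma moved_mass_bounds: "0 \<le> moved_mass le P t \<beta> p" "moved_mass le P t \<beta> p \<le> \<beta> p"
  using weight_nonneg[of p] by (simp_all add: moved_mass_def min_def)

lemma moved_mass_nonzeroD:
  "moved_mass le P t \<beta> p \<noteq> 0 \<Longrightarrow> \<beta> p \<noteq> 0 \<and> mass_above le P \<beta> p < t"
  using weight_nonneg[of p] by (auto simp: moved_mass_def min_def split: if_splits)

lemma kept_mass_nonzeroD:
  "\<beta> p - moved_mass le P t \<beta> p \<noteq> 0 \<Longrightarrow> \<beta> p \<noteq> 0 \<and> t < \<beta> p + mass_above le P \<beta> p"
  using weight_nonneg[of p] by (auto simp: moved_mass_def min_def split: if_splits)

text \<open>The cases may overlap, as a vertex can keep mass and receive some. What they record is
  the position of an interval relative to t: kept mass ends after t, moved mass starts before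
  it.\<close>

lemma slide_nonzero_cases:
  assumes "slide le P c t \<beta> p \<noteq> 0"
  obtains (kept) "\<beta> p \<noteq> 0" "p \<in> P" "t < \<beta> p + mass_above le P \<beta> p"
    | (moved) q where "p = c q" "\<beta> q \<noteq> 0" "q \<in> P" "mass_above le P \<beta> q < t"
proof (cases "\<beta> p - moved_mass le P t \<beta> p = 0")
  case False
  then show ?thesis using kept_mass_nonzeroD kept chain_weights_mem[OF \<beta>] by blast
next
  case True
  then have "(\<Sum>q\<in>P. if c q = p then moved_mass le P t \<beta> q else 0) \<noteq> 0"
    using assms by (simp add: slide_def)
  then obtain q where "q \<in> P" "(if c q = p then moved_mass le P t \<beta> q else 0) \<noteq> 0"
    by (rule sum.not_neutral_contains_not_neutral)
  then show ?thesis using moved moved_mass_nonzeroD[of t q] by (auto split: if_splits)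
qed

text \<open>Here the top-down order pays off: a kept p cannot lie strictly above a moved q, since
  then the interval of p would end before that of q starts, hence before t. So p is below q, and q
  is below its closure.\<close>

lemma kept_le_moved:
  assumes p: "\<beta> p \<noteq> 0" "p \<in> P" "t < \<beta> p + mass_above le P \<beta> p"
    and q: "\<beta> q \<noteq> 0" "q \<in> P" "mass_above le P \<beta> q < t"
  shows "le p (c q)"
proof -
  have "le p q"
  proof (rule ccontr)
    assume n: "\<not> le p q"
    then have "le q p" using \<beta> p(1) q(1) unfolding chain_weights_iff[OF finite] by blast
    moreover have "q \<noteq> p" using n refl p(2) by blast
    ultimately show False using mass_above_less[OF q(2) p(2)] p(3) q(3) by linarith
  qed
  then show ?thesis using trans[OF p(2) q(2) c_in[OF q(2)]] c_ext[OF q(2)] by blast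
qed

text \<open>Comparability splits three ways: two kept vertices belong to the old chain, two moved
  ones are compared by monotonicity of c, and a mixed pair by \<open>kept_le_moved\<close>.\<close>

lemma slide_chain_weights: "slide le P c t \<beta> \<in> chain_weights le P"
proof -
  have "0 \<le> slide le P c t \<beta> p" for p
    unfolding slide_def using moved_mass_bounds
    by (intro add_nonneg_nonneg sum_nonneg) auto
  moreover have "p \<in> P" if "slide le P c t \<beta> p \<noteq> 0" for p
    using that by (cases rule: slide_nonzero_cases) (auto simp: c_in)
  moreover have "le p q \<or> le q p" if p: "slide le P c t \<beta> p \<noteq> 0" and q: "slide le P c t \<beta> q \<noteq> 0" for p q
  proof -
    have chain: "le r s \<or> le s r" if "\<beta> r \<noteq> 0" "\<beta> s \<noteq> 0" for r s
      using \<beta> that by (simp add: chain_weights_iff[OF finite])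
    from p show ?thesis
    proof (cases rule: slide_nonzero_cases)
      case kept
      from q show ?thesis
        by (cases rule: slide_nonzero_cases) (use kept chain kept_le_moved in auto)
    next
      case (moved r)
      from q show ?thesis
      proof (cases rule: slide_nonzero_cases)
        case (moved s)
        then show ?thesis using \<open>p = c r\<close> \<open>\<beta> r \<noteq> 0\<close> \<open>r \<in> P\<close> chain c_mono by blast
      qed (use moved kept_le_moved in auto)
    qed
  qed
  moreover have "sum (slide le P c t \<beta>) P = 1"
  proof -
    have "(\<Sum>p\<in>P. \<Sum>q\<in>P. if c q = p then moved_mass le P t \<beta> q else 0) = sum (moved_mass le P t \<beta>) P"
      using finite c_in by (subst sum.swap) simp
    then have "sum (slide le P c t \<beta>) P = sum \<beta> P"
      by (simp add: slide_def sum.distrib sum_subtractf)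
    then show ?thesis using \<beta> by (simp add: chain_weights_iff[OF finite])
  qed
  ultimately show ?thesis by (simp add: chain_weights_iff[OF finite])
qed

lemma slide_0: "slide le P c 0 \<beta> = \<beta>"
proof -
  have "moved_mass le P 0 \<beta> p = 0" for p
    using weight_nonneg[of p] mass_above_nonneg[of p] by (simp add: moved_mass_def)
  then show ?thesis by (auto simp: slide_def fun_eq_iff intro!: sum.neutral)
qed

text \<open>Each vertex of the support gets back precisely the mass taken from it. This makes the
  deformation stationary on the image of the embedding.\<close>

lemma slide_fixed:
  assumes "\<And>p. \<beta> p \<noteq> 0 \<Longrightarrow> c p = p"
  shows "slide le P c t \<beta> = \<beta>"
proof
  fix p
  have "(\<Sum>q\<in>P. if c q = p then moved_mass le P t \<beta> q else 0) =
      (\<Sum>q\<in>P. if p = q then moved_mass le P t \<beta> q else 0)"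
    using assms moved_mass_nonzeroD by (intro sum.cong) fastforce+
  also have "\<dots> = moved_mass le P t \<beta> p"
    using finite moved_mass_nonzeroD[of t p] chain_weights_mem[OF \<beta>, of p] by auto
  finally show "slide le P c t \<beta> p = \<beta> p" by (simp add: slide_def)
qed

text \<open>At time 1 nothing can be kept, as no interval extends beyond 1; all mass sits on values
  of c, which are closed by idempotence.\<close>

lemma slide_1_fixed:
  assumes "slide le P c 1 \<beta> p \<noteq> 0"
  shows "c p = p"
  using assms
proof (cases rule: slide_nonzero_cases)
  case kept
  then show ?thesis using mass_above_le1[of p] by linarith
qed (simp add: c_idem)

end

end

section \<open>Proper maps between homotopy colimits\<close>

lemma Hausdorff_space_realization:
  fixes D :: "('p, 'x::euclidean_space) diagram"
  shows "Hausdorff_space (top_of_set (realization D))"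
proof -
  have "Hausdorff_space (euclidean :: ('p \<Rightarrow> real) topology)"
    unfolding euclidean_product_topology[symmetric] by (simp add: Hausdorff_space_product_topology)
  then have "Hausdorff_space (prod_topology (euclidean :: ('p \<Rightarrow> real) topology) (euclidean :: 'x topology))"
    by (simp add: Hausdorff_space_prod_topology del: prod_topology_euclidean)
  then show ?thesis by (simp add: Hausdorff_space_subtopology)
qed

text \<open>The realization is closed in the product of a compact set of weights with a Euclidean
  space.\<close>

lemma locally_compact_space_realization:
  fixes D :: "('p, 'x::euclidean_space) diagram"
  assumes "inclusion_diagram D"
  shows "locally_compact_space (top_of_set (realization D))"
proof -
  interpret inclusion_diagram D by fact
  let ?W = "chain_weights (leq D) (objs D)"
  have "compact_space (top_of_set ?W)"
    using compact_chain_weights[OF finite] by (simp add: compact_space_subtopology)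
  then have "locally_compact_space (prod_topology (top_of_set ?W) (euclidean :: 'x topology))"
    by (simp add: locally_compact_space_prod_topology compact_imp_locally_compact_space
        locally_compact_space_euclidean)
  then have loc: "locally_compact_space (top_of_set (?W \<times> (UNIV :: 'x set)))"
    by (metis prod_topology_euclidean subtopology_Times subtopology_UNIV)
  have sub: "realization D \<subseteq> ?W \<times> UNIV" by (auto simp: realization_def)
  then have "closedin (top_of_set (?W \<times> (UNIV :: 'x set))) (realization D)"
    using closed_realization by (simp add: closed_subset)
  from locally_compact_space_closed_subset[OF loc this] show ?thesis
    using sub by (simp add: subtopology_subtopology Int_absorb1)
qed

text \<open>F is the map on classes that acts as \<open>k t\<close> on weights and fixes x. The time
  set T is a parameter so that one statement serves the embedding, with a single time, and the
  homotopy, with the unit interval.\<close>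

lemma continuous_map_Alexandroff_hocolim:
  fixes D :: "('p, 'x::euclidean_space) diagram" and E :: "('q, 'x) diagram" and T :: "real set"
  assumes D: "inclusion_diagram D" and E: "inclusion_diagram E" and T: "compact T"
    and k: "continuous_on (T \<times> realization D) (\<lambda>z. k (fst z) (fst (snd z)))"
    and F: "\<And>t K. \<lbrakk>t \<in> T; K \<in> topspace (hocolim D)\<rbrakk> \<Longrightarrow> F t K \<in> topspace (hocolim E) \<and>
        hocolim_pt (F t K) = map_prod (k t) id (hocolim_pt K)"
  shows "continuous_map
     (prod_topology (top_of_set T) (Alexandroff_compactification (hocolim D)))
     (Alexandroff_compactification (hocolim E)) (\<lambda>(t, u). map_option (F t) u)"
proof -
  interpret D: inclusion_diagram D by fact
  interpret E: inclusion_diagram E by fact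
  obtain q where q: "homeomorphic_maps (hocolim E) (top_of_set (realization E)) hocolim_pt q"
    using E.homeomorphic_map_hocolim_pt homeomorphic_map_maps by blast
  obtain r where r: "homeomorphic_maps (hocolim D) (top_of_set (realization D)) hocolim_pt r"
    using D.homeomorphic_map_hocolim_pt homeomorphic_map_maps by blast
  define g :: "real \<times> ('p \<Rightarrow> real) \<times> 'x \<Rightarrow> ('q \<Rightarrow> real) \<times> 'x" where "g = (\<lambda>z. (k (fst z) (fst (snd z)), snd (snd z)))"
  have gF: "hocolim_pt (F t K) = g (t, hocolim_pt K)" if "t \<in> T" "K \<in> topspace (hocolim D)" for t K
    using F[OF that] by (simp add: g_def map_prod_def split_beta)
  have TR: "prod_topology (top_of_set T) (top_of_set (realization D)) = top_of_set (T \<times> realization D)"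
    by (metis prod_topology_euclidean subtopology_Times)
  have r': "r z \<in> topspace (hocolim D)" "hocolim_pt (r z) = z" if "z \<in> realization D" for z
    using r that by (auto simp: homeomorphic_maps_def continuous_map_def)
  have g_in: "g z \<in> realization E" if "z \<in> T \<times> realization D" for z
  proof -
    obtain t y where z: "z = (t, y)" "t \<in> T" "y \<in> realization D" using \<open>z \<in> T \<times> realization D\<close> by blast
    have "F t (r y) \<in> topspace (hocolim E)" using F r' z by blast
    then have "hocolim_pt (F t (r y)) \<in> realization E"
      using homeomorphic_imp_surjective_map[OF E.homeomorphic_map_hocolim_pt] by auto
    then show ?thesis using gF r' z by simp
  qed
  have cg: "continuous_on (T \<times> realization D) g"
    unfolding g_def by (intro continuous_on_Pair k continuous_on_snd continuous_on_id)
  have compact_pre: "compact {z \<in> T \<times> realization D. g z \<in> C}"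
    if C: "compact C" "closedin (top_of_set (realization E)) C" for C
  proof -
    let ?S = "{z \<in> T \<times> realization D. g z \<in> C}"
    let ?Z = "T \<times> (realization D \<inter> chain_weights (leq D) (objs D) \<times> snd ` C)"
    have "closedin (top_of_set (T \<times> realization D)) ((T \<times> realization D) \<inter> g -` C)"
      using cg C(2) g_in by (intro continuous_closedin_preimage_gen[where T = "realization E"]) auto
    moreover have "(T \<times> realization D) \<inter> g -` C = ?S" by auto
    ultimately have "closedin (top_of_set (T \<times> realization D)) ?S" by simp
    moreover have "?S \<subseteq> ?Z"
      by (auto simp: g_def realization_def intro: rev_image_eqI)
    ultimately have "closedin (top_of_set ?Z) ?S"
      by (rule closedin_subset_trans) auto
    moreover have "compact ?Z"
      using T C(1) D.closed_realization compact_chain_weights[OF D.finite]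
      by (intro compact_Times closed_Int_compact compact_continuous_image[of C snd])
         (auto intro: continuous_on_snd continuous_on_id)
    ultimately show ?thesis by (rule closedin_compact[rotated])
  qed
  have X: "Hausdorff_space (hocolim D)" "locally_compact_space (hocolim D)"
    using D.homeomorphic_map_hocolim_pt Hausdorff_space_realization[of D]
      locally_compact_space_realization[OF assms(1)]
    by (metis homeomorphic_Hausdorff_space homeomorphic_locally_compact_space homeomorphic_map_imp_homeomorphic_space)+
  let ?P = "prod_topology (top_of_set T) (hocolim D)"
  have top: "topspace ?P = T \<times> topspace (hocolim D)" by simp
  have pt_cont: "continuous_map (hocolim D) (top_of_set (realization D)) hocolim_pt"
    using r by (simp add: homeomorphic_maps_def)
  show ?thesis
  proof (rule continuous_map_Alexandroff_homotopy)
    have "continuous_map ?P (top_of_set (T \<times> realization D)) (\<lambda>(t, K). (t, hocolim_pt K))"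
      unfolding TR[symmetric] using pt_cont
      by (intro continuous_map_prod_top[THEN iffD2]) (simp add: continuous_map_id[unfolded id_def])
    moreover have "continuous_map (top_of_set (T \<times> realization D)) (top_of_set (realization E)) g"
      using cg g_in by auto
    moreover have "continuous_map (top_of_set (realization E)) (hocolim E) q"
      using q by (simp add: homeomorphic_maps_def)
    ultimately have "continuous_map ?P (hocolim E) (q \<circ> (g \<circ> (\<lambda>(t, K). (t, hocolim_pt K))))"
      by (meson continuous_map_compose)
    moreover have "(q \<circ> (g \<circ> (\<lambda>(t, K). (t, hocolim_pt K)))) z = (\<lambda>(t, K). F t K) z"
      if "z \<in> topspace ?P" for z
    proof -
      obtain t K where z: "z = (t, K)" "t \<in> T" "K \<in> topspace (hocolim D)" using \<open>z \<in> topspace ?P\<close> by auto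
      then have "F t K \<in> topspace (hocolim E)" using F by blast
      then have "q (hocolim_pt (F t K)) = F t K" using q unfolding homeomorphic_maps_def by blast
      then show ?thesis using z gF by simp
    qed
    ultimately show "continuous_map ?P (hocolim E) (\<lambda>(t, K). F t K)"
      by (rule continuous_map_eq)
  next
    fix C assume C: "compactin (hocolim E) C" "closedin (hocolim E) C"
    let ?C = "hocolim_pt ` C"
    have sub: "C \<subseteq> topspace (hocolim E)" using C(2) by (rule closedin_subset)
    have "compact ?C"
      using image_compactin[OF C(1) homeomorphic_imp_continuous_map[OF E.homeomorphic_map_hocolim_pt]]
      by (simp add: compactin_subtopology)
    moreover have "closedin (top_of_set (realization E)) ?C"
      using homeomorphic_map_closedness_eq[OF E.homeomorphic_map_hocolim_pt] C(2) by blast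
    ultimately have cpt: "compact {z \<in> T \<times> realization D. g z \<in> ?C}" by (rule compact_pre)
    have "continuous_map (top_of_set (T \<times> realization D)) ?P (\<lambda>(t, z). (t, r z))"
      unfolding TR[symmetric] using r
      by (intro continuous_map_prod_top[THEN iffD2]) (simp add: homeomorphic_maps_def continuous_map_id[unfolded id_def])
    moreover have "compactin (top_of_set (T \<times> realization D)) {z \<in> T \<times> realization D. g z \<in> ?C}"
      using cpt by (simp add: compactin_subtopology Collect_restrict)
    ultimately have "compactin ?P ((\<lambda>(t, z). (t, r z)) ` {z \<in> T \<times> realization D. g z \<in> ?C})"
      by (rule image_compactin[rotated])
    moreover have "(\<lambda>(t, z). (t, r z)) ` {z \<in> T \<times> realization D. g z \<in> ?C} =
        {(t, K) \<in> topspace ?P. F t K \<in> C}" (is "?l = ?r")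
    proof (intro equalityI subsetI)
      fix w assume "w \<in> ?l"
      then obtain t z where w: "w = (t, r z)" "t \<in> T" "z \<in> realization D" "g (t, z) \<in> ?C" by auto
      then obtain L where L: "L \<in> C" "g (t, z) = hocolim_pt L" by auto
      have "hocolim_pt (F t (r z)) = hocolim_pt L" using gF r' w L by simp
      then have "F t (r z) = L"
        using homeomorphic_imp_injective_map[OF E.homeomorphic_map_hocolim_pt] F[OF w(2) r'(1)[OF w(3)]] L sub
        by (auto dest: inj_onD)
      then show "w \<in> ?r" using w r' L by simp
    next
      fix w assume "w \<in> ?r"
      then obtain t K where w: "w = (t, K)" "t \<in> T" "K \<in> topspace (hocolim D)" "F t K \<in> C" by auto
      then have "hocolim_pt K \<in> realization D" "r (hocolim_pt K) = K"
        using r by (auto simp: homeomorphic_maps_def continuous_map_def)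
      moreover have "g (t, hocolim_pt K) \<in> ?C" using gF w by (metis imageI)
      ultimately show "w \<in> ?l" using w by (intro image_eqI[of _ _ "(t, hocolim_pt K)"]) auto
    qed
    ultimately show "compactin ?P {(t, K) \<in> topspace ?P. F t K \<in> C}" by simp
  qed (use X in \<open>auto simp: Hausdorff_space_subtopology\<close>)
qed

section \<open>The deformation retraction\<close>

text \<open>Intersecting a simplex and collecting the members that contain a given subspace form a
  Galois connection; this is its closure operator.\<close>

lemma closure_operator_nerve:
  assumes "finite \<A>" "\<And>a. a \<in> \<A> \<Longrightarrow> closed a"
  shows "closure_operator (\<subseteq>) (nerve \<A>) (\<lambda>\<sigma>. complete_simplex \<A> (\<Inter>\<sigma>))"
proof -
  interpret inclusion_diagram "Vassiliev \<A>" using assms by (rule inclusion_diagram_Vassiliev)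
  have *: "\<Inter>\<sigma> \<in> intersections \<A>" if "\<sigma> \<in> nerve \<A>" for \<sigma>
    using that by (auto simp: nerve_def intersections_def)
  have "finite_poset (\<subseteq>) (nerve \<A>)" using finite_poset_axioms by simp
  moreover have "closure_operator_axioms (\<subseteq>) (nerve \<A>) (\<lambda>\<sigma>. complete_simplex \<A> (\<Inter>\<sigma>))"
  proof
    fix \<sigma> assume \<sigma>: "\<sigma> \<in> nerve \<A>"
    show "complete_simplex \<A> (\<Inter>\<sigma>) \<in> nerve \<A>" using complete_simplex_props(1)[OF *[OF \<sigma>]] .
    show "complete_simplex \<A> (\<Inter>(complete_simplex \<A> (\<Inter>\<sigma>))) = complete_simplex \<A> (\<Inter>\<sigma>)"
      using complete_simplex_props(2)[OF *[OF \<sigma>]] by simp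
    show "\<sigma> \<subseteq> complete_simplex \<A> (\<Inter>\<sigma>)"
      using \<sigma> by (auto simp: nerve_def complete_simplex_def)
  qed (simp add: complete_simplex_antimono Inter_anti_mono)
  ultimately show ?thesis by (rule closure_operator.intro)
qed

text \<open>Complete simplices and elements of the semilattice determine each other, so the weights
  can be relabelled back. Comparability survives because intersecting
  \<open>complete_simplex \<A> x\<close> recovers x and reverses inclusions.\<close>

lemma complete_realization_is_image:
  assumes fin: "finite \<A>" and cl: "\<And>a. a \<in> \<A> \<Longrightarrow> closed a"
    and r: "(\<gamma>, d) \<in> realization (Vassiliev \<A>)"
    and complete: "\<And>\<sigma>. \<gamma> \<sigma> \<noteq> 0 \<Longrightarrow> complete_simplex \<A> (\<Inter>\<sigma>) = \<sigma>"
  shows "\<exists>\<alpha>. (\<alpha>, d) \<in> realization (ZZ \<A>) \<and> push_coords (complete_simplex \<A>) \<alpha> = \<gamma>"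
proof -
  let ?\<kappa> = "complete_simplex \<A>" and ?L = "intersections \<A>"
  interpret Z: inclusion_diagram "ZZ \<A>" using fin cl by (rule inclusion_diagram_ZZ)
  interpret V: inclusion_diagram "Vassiliev \<A>" using fin cl by (rule inclusion_diagram_Vassiliev)
  have finL: "finite ?L" and finN: "finite (nerve \<A>)" using Z.finite V.finite by simp_all
  \<comment> \<open>The value 0 off the semilattice is forced, as coordinates vanish off the poset;
    \<open>complete_simplex\<close> also makes sense for sets that are not intersections.\<close>
  define \<alpha> where "\<alpha> = (\<lambda>x. if x \<in> ?L then \<gamma> (?\<kappa> x) else 0)"
  have \<gamma>: "\<gamma> \<in> chain_weights (\<subseteq>) (nerve \<A>)" and d: "\<And>\<sigma>. \<gamma> \<sigma> \<noteq> 0 \<Longrightarrow> d \<in> \<Inter>\<sigma>"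
    using r by (auto simp: realization_def)
  have \<kappa>: "\<Inter>\<sigma> \<in> ?L" "?\<kappa> (\<Inter>\<sigma>) = \<sigma>" if "\<gamma> \<sigma> \<noteq> 0" for \<sigma>
    using chain_weights_mem[OF \<gamma> that] complete[OF that] by (auto simp: nerve_def intersections_def)
  have nz: "x \<in> ?L" "\<gamma> (?\<kappa> x) \<noteq> 0" if "\<alpha> x \<noteq> 0" for x
    using that by (auto simp: \<alpha>_def split: if_splits)
  have "sum \<alpha> ?L = sum \<gamma> (?\<kappa> ` ?L)"
    by (simp add: \<alpha>_def sum.reindex[OF inj_on_complete_simplex])
  also have "\<dots> = sum \<gamma> (nerve \<A>)"
  proof (rule sum.mono_neutral_left)
    show "\<forall>\<sigma>\<in>nerve \<A> - ?\<kappa> ` ?L. \<gamma> \<sigma> = 0" using \<kappa> by (metis DiffD2 imageI)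
  qed (use finN complete_simplex_props(1) in auto)
  also have "\<dots> = 1" using \<gamma> by (simp add: chain_weights_iff[OF finN])
  finally have "sum \<alpha> ?L = 1" .
  moreover have "y \<subseteq> x \<or> x \<subseteq> y" if "\<alpha> x \<noteq> 0" "\<alpha> y \<noteq> 0" for x y
  proof -
    have "?\<kappa> x \<subseteq> ?\<kappa> y \<or> ?\<kappa> y \<subseteq> ?\<kappa> x"
      using \<gamma> nz(2)[OF that(1)] nz(2)[OF that(2)] unfolding chain_weights_iff[OF finN] by blast
    then show ?thesis
      using complete_simplex_props(2)[OF nz(1)[OF that(1)]] complete_simplex_props(2)[OF nz(1)[OF that(2)]]
      by (metis Inter_anti_mono)
  qed
  moreover have "0 \<le> \<alpha> x" for x using \<gamma> by (simp add: \<alpha>_def chain_weights_def)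
  ultimately have "\<alpha> \<in> chain_weights (\<lambda>x y. y \<subseteq> x) ?L"
    using nz(1) by (simp add: chain_weights_iff[OF finL])
  moreover have "d \<in> x" if "\<alpha> x \<noteq> 0" for x
    using d[OF nz(2)[OF that]] complete_simplex_props(2)[OF nz(1)[OF that]] by simp
  ultimately have "(\<alpha>, d) \<in> realization (ZZ \<A>)"
    by (simp add: realization_def)
  moreover have "push_coords ?\<kappa> \<alpha> = \<gamma>"
  proof
    fix \<sigma>
    show "push_coords ?\<kappa> \<alpha> \<sigma> = \<gamma> \<sigma>"
    proof (cases "\<gamma> \<sigma> = 0")
      case True
      then have "push_coords ?\<kappa> \<alpha> \<sigma> = 0"
        using push_coords_nonzeroD[of ?\<kappa> \<alpha> \<sigma>] nz(2) by blast
      then show ?thesis using True by simp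
    next
      case False
      have "push_coords ?\<kappa> \<alpha> (?\<kappa> (\<Inter>\<sigma>)) = \<alpha> (\<Inter>\<sigma>)"
        using nz(1) \<kappa>(1)[OF False] by (intro push_coords_inj[OF inj_on_complete_simplex])
      then show ?thesis using \<kappa>[OF False] by (simp add: \<alpha>_def)
    qed
  qed
  ultimately show ?thesis by blast
qed

text \<open>\<open>push_coords\<close> sums over the support, which varies with the point; on the
  realization it agrees with a sum over all of \<open>objs D\<close>, whose continuity is
  evident.\<close>

lemma continuous_on_push_coords_realization:
  assumes "inclusion_diagram D"
  shows "continuous_on (S \<times> realization D) (\<lambda>z. push_coords \<phi> (fst (snd z)))"
proof (rule continuous_on_coordinatewise_then_product)
  interpret inclusion_diagram D by fact
  fix q
  have "continuous_on (S \<times> realization D) (\<lambda>z. fst (snd z) p)" for p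
    by (rule continuous_on_product_then_coordinatewise[OF
          continuous_on_fst[OF continuous_on_snd[OF continuous_on_id]]])
  then have "continuous_on (S \<times> realization D) (\<lambda>z. if \<phi> p = q then fst (snd z) p else 0)" for p
    by (cases "\<phi> p = q") (simp_all add: continuous_on_const)
  then have "continuous_on (S \<times> realization D)
      (\<lambda>z. \<Sum>p\<in>objs D. if \<phi> p = q then fst (snd z) p else 0)"
    by (rule continuous_on_sum)
  moreover have "push_coords \<phi> (fst (snd z)) q = (\<Sum>p\<in>objs D. if \<phi> p = q then fst (snd z) p else 0)"
    if "z \<in> S \<times> realization D" for z
  proof (rule push_coords_eq[OF finite])
    have "fst (snd z) \<in> chain_weights (leq D) (objs D)" using that by (auto simp: realization_def)
    from chain_weights_mem[OF this] show "{p. fst (snd z) p \<noteq> 0} \<subseteq> objs D" by blast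
  qed
  ultimately show "continuous_on (S \<times> realization D) (\<lambda>z. push_coords \<phi> (fst (snd z)) q)"
    by (simp cong: continuous_on_cong)
qed

theorem theorem4p5:
  fixes \<A> :: "(real ^ 'n) set set"
  assumes "affine_arrangement \<A>"
  shows "embedding_map (Alexandroff_compactification (hocolim (ZZ \<A>)))
                       (Alexandroff_compactification (hocolim (Vassiliev \<A>)))
                       (map_option (ZZ_to_Vassiliev \<A>)) \<and>
         deformation_retract_of_space
           (map_option (ZZ_to_Vassiliev \<A>) `
              topspace (Alexandroff_compactification (hocolim (ZZ \<A>))))
           (Alexandroff_compactification (hocolim (Vassiliev \<A>)))"
proof -
  have fin: "finite \<A>" and cl: "\<And>a. a \<in> \<A> \<Longrightarrow> closed a"
    using assms by (auto simp: affine_arrangement_def affine_closed)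
  have Z: "inclusion_diagram (ZZ \<A>)" and V: "inclusion_diagram (Vassiliev \<A>)"
    using fin cl by (auto intro: inclusion_diagram_ZZ inclusion_diagram_Vassiliev)
  interpret Z: inclusion_diagram "ZZ \<A>" by (rule Z)
  interpret V: inclusion_diagram "Vassiliev \<A>" by (rule V)
  let ?\<kappa> = "complete_simplex \<A>" and ?j = "ZZ_to_Vassiliev \<A>"
  let ?c = "\<lambda>\<sigma>. ?\<kappa> (\<Inter>\<sigma>)"
  interpret closure_operator "(\<subseteq>)" "nerve \<A>" ?c using fin cl by (rule closure_operator_nerve)
  let ?X = "hocolim (ZZ \<A>)" and ?Y = "hocolim (Vassiliev \<A>)"
  let ?X' = "Alexandroff_compactification ?X" and ?Y' = "Alexandroff_compactification ?Y"
  let ?s = "slide (\<subseteq>) (nerve \<A>) ?c"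
  note j = ZZ_to_Vassiliev_pt[OF fin cl]
  have ptX: "hocolim_pt ` topspace ?X = realization (ZZ \<A>)" "inj_on hocolim_pt (topspace ?X)"
    using homeomorphic_imp_surjective_map[OF Z.homeomorphic_map_hocolim_pt]
      homeomorphic_imp_injective_map[OF Z.homeomorphic_map_hocolim_pt] by auto
  have ptY: "hocolim_pt ` topspace ?Y = realization (Vassiliev \<A>)" "inj_on hocolim_pt (topspace ?Y)"
    using homeomorphic_imp_surjective_map[OF V.homeomorphic_map_hocolim_pt]
      homeomorphic_imp_injective_map[OF V.homeomorphic_map_hocolim_pt] by auto
  have haus: "Hausdorff_space ?Y'"
    using V.homeomorphic_map_hocolim_pt Hausdorff_space_realization[of "Vassiliev \<A>"]
      locally_compact_space_realization[OF V]
    unfolding Hausdorff_space_Alexandroff_compactification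
    by (metis homeomorphic_Hausdorff_space homeomorphic_locally_compact_space
        homeomorphic_map_imp_homeomorphic_space)

  \<comment> \<open>The embedding is treated as a homotopy over the single time 0, and the time
    coordinate is then filled in.\<close>
  have "continuous_map (prod_topology (top_of_set {0 :: real}) ?X') ?Y' (\<lambda>(t, u). map_option ?j u)"
    using j by (intro continuous_map_Alexandroff_hocolim[OF Z V, where k = "\<lambda>_. push_coords ?\<kappa>"]
        continuous_on_push_coords_realization[OF Z]) auto
  moreover have "continuous_map ?X' (prod_topology (top_of_set {0 :: real}) ?X') (\<lambda>u. (0, u))"
    by (intro continuous_map_pairedI) auto
  ultimately have "continuous_map ?X' ?Y' ((\<lambda>(t, u). map_option ?j u) \<circ> (\<lambda>u. (0 :: real, u)))"
    by (rule continuous_map_compose[rotated])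
  then have cont_j: "continuous_map ?X' ?Y' (map_option ?j)" by (simp add: o_def)
  have wtX: "fst (hocolim_pt K) \<in> chain_weights (leq (ZZ \<A>)) (intersections \<A>)"
    if "K \<in> topspace ?X" for K
  proof -
    have "hocolim_pt K \<in> realization (ZZ \<A>)" using that ptX(1) by blast
    then show ?thesis by (auto simp: realization_def)
  qed
  have inj_j: "inj_on ?j (topspace ?X)"
  proof (rule inj_onI)
    fix K L assume K: "K \<in> topspace ?X" and L: "L \<in> topspace ?X" and eq: "?j K = ?j L"
    obtain \<alpha> x where Kx: "hocolim_pt K = (\<alpha>, x)" by fastforce
    obtain \<beta> y where Ly: "hocolim_pt L = (\<beta>, y)" by fastforce
    have push_eq: "push_coords ?\<kappa> \<alpha> = push_coords ?\<kappa> \<beta>" and "x = y"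
      using j(2)[OF _ K] j(2)[OF _ L] eq by (simp_all add: Kx Ly)
    have "\<alpha> \<in> chain_weights (leq (ZZ \<A>)) (intersections \<A>)"
      "\<beta> \<in> chain_weights (leq (ZZ \<A>)) (intersections \<A>)"
      using wtX[OF K] wtX[OF L] by (simp_all add: Kx Ly)
    then have mem: "\<alpha> p \<noteq> 0 \<Longrightarrow> p \<in> intersections \<A>" "\<beta> p \<noteq> 0 \<Longrightarrow> p \<in> intersections \<A>" for p
      using chain_weights_mem by metis+
    have "\<alpha> p = \<beta> p" for p
    proof (cases "p \<in> intersections \<A>")
      case True
      have "\<alpha> p = push_coords ?\<kappa> \<alpha> (?\<kappa> p)"
        using push_coords_inj[OF inj_on_complete_simplex mem(1) True] by simp
      also have "\<dots> = push_coords ?\<kappa> \<beta> (?\<kappa> p)" using push_eq by simp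
      also have "\<dots> = \<beta> p" using push_coords_inj[OF inj_on_complete_simplex mem(2) True] by simp
      finally show ?thesis .
    qed (use mem in metis)
    then have "hocolim_pt K = hocolim_pt L" using \<open>x = y\<close> by (simp add: Kx Ly fun_eq_iff)
    then show "K = L" using K L by (rule inj_onD[OF ptX(2)])
  qed
  have "inj_on (map_option ?j) (topspace ?X')"
    using inj_j by (auto simp: inj_on_def)
  \<comment> \<open>The source is compact and the target Hausdorff, so injectivity and continuity
    suffice.\<close>
  then have emb: "embedding_map ?X' ?Y' (map_option ?j)"
    using cont_j haus by (intro continuous_imp_embedding_map) auto

  define q where "q = inv_into (topspace ?Y) hocolim_pt"
  \<comment> \<open>The homotopy is prescribed on pairs, with x fixed, and transported to classes by
    q, the inverse of \<open>hocolim_pt\<close>.\<close>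
  define F where "F = (\<lambda>t K. q (map_prod (?s t) id (hocolim_pt K)))"
  have q: "q z \<in> topspace ?Y" "hocolim_pt (q z) = z" if "z \<in> realization (Vassiliev \<A>)" for z
    unfolding q_def using that inv_into_into[of z hocolim_pt "topspace ?Y"]
      f_inv_into_f[of z hocolim_pt "topspace ?Y"] by (simp_all add: ptY(1))
  have slide_in: "(?s t \<beta>, x) \<in> realization (Vassiliev \<A>)"
    if "(\<beta>, x) \<in> realization (Vassiliev \<A>)" for t \<beta> x
  proof -
    have \<beta>: "\<beta> \<in> chain_weights (\<subseteq>) (nerve \<A>)" and x: "\<And>\<sigma>. \<beta> \<sigma> \<noteq> 0 \<Longrightarrow> x \<in> \<Inter>\<sigma>"
      using that by (auto simp: realization_def)
    have "x \<in> \<Inter>\<sigma>" if "?s t \<beta> \<sigma> \<noteq> 0" for \<sigma>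
      using \<beta> that
    proof (cases rule: slide_nonzero_cases)
      \<comment> \<open>Closing a simplex adds only subspaces that contain its intersection, so x,
        which lies in that intersection, lies in the added subspaces too.\<close>
      case (moved \<tau>)
      then show ?thesis using x[of \<tau>] by (auto simp: complete_simplex_def)
    qed (rule x)
    then show ?thesis using slide_chain_weights[OF \<beta>] by (simp add: realization_def)
  qed
  have F: "F t K \<in> topspace ?Y" "hocolim_pt (F t K) = map_prod (?s t) id (hocolim_pt K)"
    if K: "K \<in> topspace ?Y" for t K
  proof -
    have "hocolim_pt K \<in> realization (Vassiliev \<A>)" using K ptY(1) by blast
    then have "map_prod (?s t) id (hocolim_pt K) \<in> realization (Vassiliev \<A>)"
      using slide_in by (cases "hocolim_pt K") simp
    then show "F t K \<in> topspace ?Y" "hocolim_pt (F t K) = map_prod (?s t) id (hocolim_pt K)"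
      unfolding F_def using q by blast+
  qed
  have wt: "fst (hocolim_pt K) \<in> chain_weights (\<subseteq>) (nerve \<A>)" if "K \<in> topspace ?Y" for K
  proof -
    have "hocolim_pt K \<in> realization (Vassiliev \<A>)" using that ptY(1) by blast
    then show ?thesis by (auto simp: realization_def)
  qed
  have F_eqI: "F t K = K" if K: "K \<in> topspace ?Y" and "?s t (fst (hocolim_pt K)) = fst (hocolim_pt K)" for t K
  proof -
    have "hocolim_pt (F t K) = hocolim_pt K"
      using F(2)[OF K] that by (simp add: map_prod_def split_beta)
    then show ?thesis using F(1)[OF K] K by (rule inj_onD[OF ptY(2)])
  qed
  let ?S = "map_option ?j ` topspace ?X'"
  have S: "?S = insert None (Some ` ?j ` topspace ?X)"
    by (simp add: image_image)
  have cont_F: "continuous_map (prod_topology (top_of_set {0..1}) ?Y') ?Y' (\<lambda>(t, u). map_option (F t) u)"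
  proof (rule continuous_map_Alexandroff_hocolim[OF V V, where k = ?s])
    have "continuous_on ({0..1} \<times> realization (Vassiliev \<A>)) (\<lambda>z. (fst z, fst (snd z)))"
      by (intro continuous_on_Pair continuous_on_fst continuous_on_snd continuous_on_id)
    from continuous_on_compose2[OF continuous_on_slide[of UNIV "(\<subseteq>)" "nerve \<A>" ?c] this]
    show "continuous_on ({0..1} \<times> realization (Vassiliev \<A>)) (\<lambda>z. ?s (fst z) (fst (snd z)))"
      by simp
  qed (use F in auto)
  have fixed: "F t K = K" if "K \<in> ?j ` topspace ?X" for t K
  proof -
    from that obtain L where L: "L \<in> topspace ?X" "K = ?j L" by blast
    have K: "K \<in> topspace ?Y" using j(1)[OF _ L(1)] L(2) by blast
    obtain \<alpha> x where \<alpha>x: "hocolim_pt L = (\<alpha>, x)" by fastforce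
    then have \<alpha>: "\<alpha> \<in> chain_weights (leq (ZZ \<A>)) (intersections \<A>)" using wtX[OF L(1)] by simp
    have "fst (hocolim_pt K) = push_coords ?\<kappa> \<alpha>" using j(2)[OF _ L(1)] by (simp add: L(2) \<alpha>x)
    \<comment> \<open>Weights in the image are supported on complete simplices, and these are the
      closed elements.\<close>
    moreover have "?c \<sigma> = \<sigma>" if "push_coords ?\<kappa> \<alpha> \<sigma> \<noteq> 0" for \<sigma>
      using push_coords_nonzeroD[OF that] chain_weights_mem[OF \<alpha>] complete_simplex_props(2) by metis
    ultimately show ?thesis
      by (intro F_eqI K slide_fixed wt) simp
  qed
  \<comment> \<open>At time 1 the weights sit on closed simplices and so come from the semilattice.
    The corresponding class of the smaller colimit is mapped to \<open>F 1 K\<close> because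
    \<open>hocolim_pt\<close> separates classes.\<close>
  have retract: "F 1 K \<in> ?j ` topspace ?X" if K: "K \<in> topspace ?Y" for K
  proof -
    obtain \<beta> x where \<beta>x: "hocolim_pt K = (\<beta>, x)" by fastforce
    then have "\<beta> \<in> chain_weights (\<subseteq>) (nerve \<A>)" using wt[OF K] by simp
    note fix1 = slide_1_fixed[OF this]
    have ptF: "hocolim_pt (F 1 K) = (?s 1 \<beta>, x)" using F(2)[OF K] by (simp add: \<beta>x)
    then have "(?s 1 \<beta>, x) \<in> realization (Vassiliev \<A>)" using F(1)[OF K] ptY(1) by (metis imageI)
    then have "\<exists>\<alpha>. (\<alpha>, x) \<in> realization (ZZ \<A>) \<and> push_coords ?\<kappa> \<alpha> = ?s 1 \<beta>"
      by (intro complete_realization_is_image fin cl fix1)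
    then obtain \<alpha> where \<alpha>: "(\<alpha>, x) \<in> realization (ZZ \<A>)" "push_coords ?\<kappa> \<alpha> = ?s 1 \<beta>" by blast
    obtain L where L: "L \<in> topspace ?X" "(\<alpha>, x) = hocolim_pt L"
      using \<alpha>(1) unfolding ptX(1)[symmetric] by (rule imageE)
    then have "hocolim_pt (?j L) = hocolim_pt (F 1 K)" using j(2)[OF _ L(1)] \<alpha>(2) ptF L(2)[symmetric] by simp
    then have "?j L = F 1 K"
      using j(1)[OF _ L(1)] F(1)[OF K] by (intro inj_onD[OF ptY(2)]) auto
    then show ?thesis using L(1) by blast
  qed
  have S_sub: "?S \<subseteq> topspace ?Y'" using j(1) by (auto simp: S)
  have "homotopic_with (\<lambda>h. \<forall>x\<in>?S. h x = x) ?Y' ?Y' id (map_option (F 1))"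
  proof (subst homotopic_with)
    \<comment> \<open>The characterization of \<open>homotopic_with\<close> asks that the predicate
      depend only on values on the space, which holds because \<open>?S\<close> lies in it.\<close>
    show "(\<forall>x\<in>?S. h x = x) \<longleftrightarrow> (\<forall>x\<in>?S. k x = x)"
      if "\<And>x. x \<in> topspace ?Y' \<Longrightarrow> h x = k x" for h k
    proof (rule ball_cong[OF HOL.refl])
      fix x assume "x \<in> ?S"
      then have "h x = k x" using S_sub by (intro that) (rule subsetD)
      then show "h x = x \<longleftrightarrow> k x = x" by simp
    qed
    have "F 0 K = K" if "K \<in> topspace ?Y" for K
      using that by (intro F_eqI slide_0 wt)
    then have F0: "\<forall>u\<in>topspace ?Y'. map_option (F 0) u = u" by auto
    have "\<forall>u\<in>?S. map_option (F t) u = u" for t using fixed by (auto simp: S)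
    with cont_F F0 show "\<exists>h. continuous_map (prod_topology (top_of_set {0..1 :: real}) ?Y') ?Y' h \<and>
        (\<forall>x\<in>topspace ?Y'. h (0, x) = id x) \<and> (\<forall>x\<in>topspace ?Y'. h (1, x) = map_option (F 1) x) \<and>
        (\<forall>t\<in>{0..1}. \<forall>x\<in>?S. h (t, x) = x)"
      by (intro exI[where x = "\<lambda>(t, u). map_option (F t) u"] conjI) (simp_all only: prod.case id_apply, blast+)
  qed
  moreover have "map_option (F 1) ` topspace ?Y' \<subseteq> ?S"
    unfolding S using retract by auto
  ultimately have "deformation_retract_of_space ?S ?Y'"
    unfolding deformation_retract_of_space_def using S_sub by blast
  with emb show ?thesis by blast
qed

end
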